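(* A digraph $H$ is a hero in oriented chordal graphs if and only if $H$ is a transitive tournament or $H$ is isomorphic to $\vec{C}_3(1,1,k)$ for some integer $k\ge 1$.
   Context: An oriented chordal graph is an orientation (each edge given exactly one direction) of a chordal graph, i.e. of a graph in which every cycle of length at least 4 has a chord. The dichromatic number of a digraph is the least number of parts in a partition of its vertex set into sets inducing acyclic subdigraphs. A digraph $H$ is a hero in a class $\mathcal{C}$ if there is a constant $c$ such that every digraph in $\mathcal{C}$ with no induced subdigraph isomorphic to $H$ has dichromatic number at most $c$. A transitive tournament is an acyclic tournament. For digraphs $D_1,D_2,D_3$, $\vec{C}_3(D_1,D_2,D_3)$ is obtained from their disjoint union by adding all arcs from $D_1$ to $D_2$, from $D_2$ to $D_3$ and from $D_3$ to $D_1$, where an integer $m$ stands for the transitive tournament on $m$ vertices. *)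

theory Defs
  imports "Graph_Theory.Graph_Theory" "HOL-Library.Disjoint_Sets"
begin

text \<open>Digraphs are finite, loopless and without parallel arcs (\<open>pair_digraph\<close>); digons are
  allowed in general.  Undirected graphs are symmetric digraphs (\<open>pair_graph\<close>): an edge
  is a pair of opposite arcs.\<close>

text \<open>The vertices of a closed walk are the tails of its arcs. In a \<open>pair_graph\<close>, a \<open>cycle\<close> with
  at least three arcs is a cycle of the undirected graph (a single edge traversed
  back and forth also counts as a \<open>cycle\<close>, but it has only two arcs).\<close>

definition has_chord :: "'a pair_pre_digraph \<Rightarrow> ('a \<times> 'a) awalk \<Rightarrow> bool" where
  "has_chord G p \<longleftrightarrow>
    (\<exists>u \<in> fst ` set p. \<exists>v \<in> fst ` set p.
      (u, v) \<in> parcs G \<and> (u, v) \<notin> set p \<and> (v, u) \<notin> set p)"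

definition chordal_graph :: "'a pair_pre_digraph \<Rightarrow> bool" where
  "chordal_graph G \<longleftrightarrow> pair_graph G \<and>
    (\<forall>p. pre_digraph.cycle (with_proj G) p \<and> 4 \<le> length p \<longrightarrow> has_chord G p)"

definition orientation_of :: "'a pair_pre_digraph \<Rightarrow> 'a pair_pre_digraph \<Rightarrow> bool" where
  "orientation_of D G \<longleftrightarrow> pverts D = pverts G \<and>
    parcs G = parcs D \<union> (parcs D)\<inverse> \<and> parcs D \<inter> (parcs D)\<inverse> = {}"

definition oriented_chordal :: "'a pair_pre_digraph \<Rightarrow> bool" where
  "oriented_chordal D \<longleftrightarrow> (\<exists>G. chordal_graph G \<and> orientation_of D G)"

definition acyclic_digraph :: "('a, 'b) pre_digraph \<Rightarrow> bool" where
  "acyclic_digraph D \<longleftrightarrow> \<not> (\<exists>p. pre_digraph.cycle D p)"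

text \<open>For a finite loopless digraph the partition into singletons shows that the minimum is
  over a nonempty set.\<close>

definition dichromatic_number :: "'a pair_pre_digraph \<Rightarrow> nat" where
  "dichromatic_number D =
    (LEAST k. \<exists>P. partition_on (pverts D) P \<and> finite P \<and> card P = k \<and>
      (\<forall>X \<in> P. acyclic_digraph (with_proj D \<restriction> X)))"

definition contains_induced :: "'b pair_pre_digraph \<Rightarrow> 'a pair_pre_digraph \<Rightarrow> bool" where
  "contains_induced D H \<longleftrightarrow>
    (\<exists>S. induced_subgraph S (with_proj D) \<and> digraph_iso (with_proj H) S)"

definition hero_in :: "'b pair_pre_digraph set \<Rightarrow> 'a pair_pre_digraph \<Rightarrow> bool" where
  "hero_in \<C> H \<longleftrightarrow>
    (\<exists>c. \<forall>D \<in> \<C>. \<not> contains_induced D H \<longrightarrow> dichromatic_number D \<le> c)"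

text \<open>Every finite digraph is isomorphic to one whose vertices are natural numbers, so the class
  of all oriented chordal graphs is represented, up to isomorphism, by the following set.\<close>

definition oriented_chordal_graphs :: "nat pair_pre_digraph set" where
  "oriented_chordal_graphs = {D. oriented_chordal D}"

definition tournament :: "'a pair_pre_digraph \<Rightarrow> bool" where
  "tournament T \<longleftrightarrow> pair_digraph T \<and>
    (\<forall>u \<in> pverts T. \<forall>v \<in> pverts T. u \<noteq> v \<longrightarrow> ((u, v) \<in> parcs T \<longleftrightarrow> (v, u) \<notin> parcs T))"

definition transitive_tournament :: "'a pair_pre_digraph \<Rightarrow> bool" where
  "transitive_tournament T \<longleftrightarrow> tournament T \<and> acyclic_digraph (with_proj T)"

definition TT :: "nat \<Rightarrow> nat pair_pre_digraph" where
  "TT m = \<lparr>pverts = {..<m}, parcs = {(i, j). i < j \<and> j < m}\<rparr>"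

definition C3 ::
  "'a pair_pre_digraph \<Rightarrow> 'b pair_pre_digraph \<Rightarrow> 'c pair_pre_digraph
    \<Rightarrow> ('a + 'b + 'c) pair_pre_digraph" where
  "C3 D1 D2 D3 =
    (let in1 = Inl; in2 = (\<lambda>y. Inr (Inl y)); in3 = (\<lambda>z. Inr (Inr z));
         V1 = in1 ` pverts D1; V2 = in2 ` pverts D2; V3 = in3 ` pverts D3
     in \<lparr>pverts = V1 \<union> V2 \<union> V3,
         parcs = map_prod in1 in1 ` parcs D1 \<union> map_prod in2 in2 ` parcs D2 \<union>
                 map_prod in3 in3 ` parcs D3 \<union> V1 \<times> V2 \<union> V2 \<times> V3 \<union> V3 \<times> V1\<rparr>)"

end

(* Reversing a perfect elimination order, a chordal graph is built by adding vertices whose earlier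
   neighbours form a clique.

   If C3(1,1,k) is excluded, colour greedily along such an order.  A new vertex x closes a directed
   triangle with each arc a -> b such that b -> x -> a.  A matching among these arcs in the clique
   of earlier neighbours has bounded size: otherwise some matching arc, or an arc at x, lies in
   triangles with 2^k vertices of a clique, which contain a transitive tournament on k vertices.
   So x only has to avoid the colours of a bounded vertex cover.  A class without directed triangles
   is acyclic, since a shortest directed cycle can be shortened at its last vertex.  Transitive
   tournaments are covered because TT k is an induced subdigraph of C3(1,1,k).

   Conversely, four families of unbounded dichromatic number leave no other candidate: tournaments
   C3(1,D,D); digraphs in which every arc u -> v of a transitive tournament receives its own copy X
   of the previous one with v => X => u, so that a clique without a vertex dominating, or dominated
   by, a directed triangle is transitive or a C3(1,1,k); digraphs in which no vertex dominates a
   directed triangle; and the reversals of the latter. *)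
theory Submission
  imports Defs
begin

section \<open>Colourings, embeddings and the library notions\<close>

text \<open>Everything is measured by directed triangles. Along an elimination order a colour class
  is acyclic as soon as it contains no directed triangle, so upper and lower bounds both speak of
  monochromatic triangles only, a condition that passes to copies and to larger digraphs. The upper
  bound rests on 2^m vertices of a tournament containing a transitive one on m vertices: among
  2^(2*2^k+1) matching tails there are 2*2^k+1 in transitive order, and the last one sorts the 2*2^k
  others into two sets, one of size at least 2^k. Counting both ends of the matching arcs doubles
  the constant. The hard family is the one where no vertex dominates a directed triangle, since a
  copy of an earlier digraph that contains a triangle may not lie in an out-neighbourhood. It grows
  by single vertices spliced into transitive lists, and its lower bound is a statement about
  colours: in a colouring with few colours and no monochromatic triangle, some transitive list
  splits into many consecutive blocks that all show the same j colours. This is absurd once j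
  exceeds the number of colours.\<close>

lemma restrict_with_proj:
  "with_proj D \<restriction> X = with_proj \<lparr>pverts = X, parcs = parcs D \<inter> X \<times> X\<rparr>"
  by (auto simp: induce_subgraph_def with_proj_def)

lemma cycle_with_proj_iff:
  "pre_digraph.cycle (with_proj D) p \<longleftrightarrow>
    (\<exists>u. u \<in> pverts D \<and> set p \<subseteq> parcs D \<and> pcas u p u \<and> distinct (tl (pawalk_verts u p)) \<and> p \<noteq> [])"
  by (auto simp: pre_digraph.cycle_def pre_digraph.awalk_def cas_with_proj_eq
      awalk_verts_with_proj_eq)

text \<open>A nonempty closed walk contains a cycle, so library cycles and transitive closures
  express the same acyclicity; from here on colour classes can be treated as plain
  relations.\<close>

lemma acyclic_digraph_restrict_iff:
  "acyclic_digraph (with_proj D \<restriction> X) \<longleftrightarrow> acyclic (parcs D \<inter> X \<times> X)"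
proof -
  let ?G = "\<lparr>pverts = X, parcs = parcs D \<inter> X \<times> X\<rparr>"
  interpret pair_wf_digraph ?G by unfold_locales auto
  have "(\<exists>p. cycle p) \<longleftrightarrow> (\<exists>u. (u, u) \<in> (parcs ?G)\<^sup>+)"
  proof
    assume "\<exists>p. cycle p"
    then show "\<exists>u. (u, u) \<in> (parcs ?G)\<^sup>+"
      using reachable1_awalkI unfolding cycle_def by auto
  next
    assume "\<exists>u. (u, u) \<in> (parcs ?G)\<^sup>+"
    then show "\<exists>p. cycle p"
      using reachable1_awalk closed_w_imp_cycle unfolding closed_w_def
      by simp (metis length_greater_0_conv)
  qed
  then show ?thesis
    unfolding acyclic_digraph_def restrict_with_proj acyclic_def by auto
qed

lemma acyclic_digraph_with_proj_iff:
  assumes "pair_wf_digraph D"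
  shows "acyclic_digraph (with_proj D) \<longleftrightarrow> acyclic (parcs D)"
proof -
  interpret pair_wf_digraph D by fact
  have "parcs D \<inter> pverts D \<times> pverts D = parcs D"
    by (auto dest: in_arcsD1 in_arcsD2)
  then show ?thesis
    using acyclic_digraph_restrict_iff[of D "pverts D"]
    by (simp add: restrict_with_proj) (simp add: with_proj_def)
qed

text \<open>Stated for bare vertex sets and relations, so that index sets, subsets and whole
  digraphs can be compared and embeddings compose without building digraph records.\<close>

definition embeds :: "'a set \<Rightarrow> 'a rel \<Rightarrow> 'b set \<Rightarrow> 'b rel \<Rightarrow> ('a \<Rightarrow> 'b) \<Rightarrow> bool" where
  "embeds V R W Q f \<longleftrightarrow> inj_on f V \<and> f ` V \<subseteq> W \<and>
    (\<forall>a\<in>V. \<forall>b\<in>V. (a, b) \<in> R \<longleftrightarrow> (f a, f b) \<in> Q)"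

text \<open>The arcs of \<open>S\<close> are pairs of their ends, so the arc map of an isomorphism
  is determined by its vertex map.\<close>

lemma digraph_isoD:
  assumes "digraph_iso (with_proj H) S" "tail S = fst" "head S = snd"
  shows "\<exists>f. bij_betw f (pverts H) (verts S) \<and> embeds (pverts H) (parcs H) (verts S) (arcs S) f"
proof -
  obtain h where h: "pre_digraph.digraph_isomorphism (with_proj H) h" "S = app_iso h (with_proj H)"
    using assms unfolding digraph_iso_def by blast
  let ?f = "iso_verts h"
  have wf: "pair_wf_digraph H"
    using h(1) by (simp add: pre_digraph.digraph_isomorphism_def wf_digraph_wp_iff)
  have inj: "inj_on ?f (pverts H)"
    using h(1) by (simp add: pre_digraph.digraph_isomorphism_def)
  have a: "iso_arcs h e = (?f (fst e), ?f (snd e))" if "e \<in> parcs H" for e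
    using h(1) assms(2,3) that unfolding h(2)
    by (auto simp: pre_digraph.digraph_isomorphism_def app_iso_def prod_eq_iff)
  have arcs: "arcs S = (\<lambda>e. (?f (fst e), ?f (snd e))) ` parcs H"
    using a unfolding h(2) by (auto simp: app_iso_def image_def)
  have v: "verts S = ?f ` pverts H" unfolding h(2) by (simp add: app_iso_def)
  have "embeds (pverts H) (parcs H) (verts S) (arcs S) ?f"
    unfolding embeds_def
  proof (intro conjI ballI)
    fix x y assume xy: "x \<in> pverts H" "y \<in> pverts H"
    show "(x, y) \<in> parcs H \<longleftrightarrow> (?f x, ?f y) \<in> arcs S"
    proof
      assume "(?f x, ?f y) \<in> arcs S"
      then obtain e where e: "e \<in> parcs H" "?f (fst e) = ?f x" "?f (snd e) = ?f y"
        unfolding arcs by auto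
      then have "fst e = x" "snd e = y"
        using inj xy pair_wf_digraph.arc_fst_in_verts[OF wf e(1)]
          pair_wf_digraph.arc_snd_in_verts[OF wf e(1)] by (auto dest: inj_onD)
      then show "(x, y) \<in> parcs H" using e(1) by auto
    qed (auto simp: arcs image_iff intro!: bexI)
  qed (use inj v in auto)
  then show ?thesis using inj v by (auto simp: bij_betw_def)
qed

lemma digraph_isoI:
  assumes "pair_wf_digraph H" "bij_betw f (pverts H) W" "Q \<subseteq> W \<times> W"
    and "embeds (pverts H) (parcs H) W Q f"
  shows "digraph_iso (with_proj H) \<lparr>verts = W, arcs = Q, tail = fst, head = snd\<rparr>"
proof -
  let ?h = "\<lparr>iso_verts = f, iso_arcs = map_prod f f, iso_head = snd, iso_tail = fst\<rparr>"
  have V: "parcs H \<subseteq> pverts H \<times> pverts H"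
    using pair_wf_digraph.in_arcsD1[OF assms(1)] pair_wf_digraph.in_arcsD2[OF assms(1)] by auto
  have f: "inj_on f (pverts H)" "W = f ` pverts H" using assms(2) by (auto simp: bij_betw_def)
  have "inj_on (map_prod f f) (parcs H)"
    using map_prod_inj_on[OF f(1) f(1)] V by (rule inj_on_subset)
  moreover have "Q = map_prod f f ` parcs H"
  proof (intro equalityI subrelI)
    fix x y assume "(x, y) \<in> Q"
    then obtain a b where "a \<in> pverts H" "b \<in> pverts H" "x = f a" "y = f b" "(f a, f b) \<in> Q"
      using assms(3) unfolding f(2) by auto
    then show "(x, y) \<in> map_prod f f ` parcs H" using assms(4) unfolding embeds_def by force
  next
    fix x y assume "(x, y) \<in> map_prod f f ` parcs H"
    then show "(x, y) \<in> Q" using assms(4) V unfolding embeds_def by auto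
  qed
  ultimately have "pre_digraph.digraph_isomorphism (with_proj H) ?h"
    and "\<lparr>verts = W, arcs = Q, tail = fst, head = snd\<rparr> = app_iso ?h (with_proj H)"
    using assms(1) f
    by (auto simp: pre_digraph.digraph_isomorphism_def wf_digraph_wp_iff app_iso_def)
  then show ?thesis unfolding digraph_iso_def by blast
qed

lemma contains_induced_iff_embeds:
  assumes "pair_wf_digraph H" "pair_wf_digraph D"
  shows "contains_induced D H \<longleftrightarrow> (\<exists>f. embeds (pverts H) (parcs H) (pverts D) (parcs D) f)"
proof
  assume "contains_induced D H"
  then obtain S where S: "induced_subgraph S (with_proj D)" "digraph_iso (with_proj H) S"
    unfolding contains_induced_def by blast
  then have S': "tail S = fst" "head S = snd" "verts S \<subseteq> pverts D"
    "arcs S = {e \<in> parcs D. fst e \<in> verts S \<and> snd e \<in> verts S}"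
    by (auto simp: induced_subgraph_def subgraph_def compatible_def)
  then obtain f where "embeds (pverts H) (parcs H) (verts S) (arcs S) f"
    using digraph_isoD[OF S(2)] by auto
  then have "embeds (pverts H) (parcs H) (pverts D) (parcs D) f"
    using S'(3,4) unfolding embeds_def by auto
  then show "\<exists>f. embeds (pverts H) (parcs H) (pverts D) (parcs D) f" by blast
next
  assume "\<exists>f. embeds (pverts H) (parcs H) (pverts D) (parcs D) f"
  then obtain f where f: "embeds (pverts H) (parcs H) (pverts D) (parcs D) f" by blast
  let ?W = "f ` pverts H"
  let ?Q = "parcs D \<inter> ?W \<times> ?W"
  let ?S = "\<lparr>verts = ?W, arcs = ?Q, tail = fst, head = snd\<rparr>"
  have "digraph_iso (with_proj H) ?S"
    by (rule digraph_isoI[OF assms(1)]) (use f in \<open>auto simp: embeds_def bij_betw_def\<close>)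
  moreover have "induced_subgraph ?S (with_proj D)"
    using f assms(2)
    by (auto simp: induced_subgraph_def subgraph_def compatible_def wf_digraph_wp_iff embeds_def
        intro!: wf_digraph.intro)
  ultimately show "contains_induced D H" unfolding contains_induced_def by blast
qed

lemma partition_acyclic_iff_colouring:
  fixes D :: "'a pair_pre_digraph"
  assumes "finite (pverts D)"
  shows "(\<exists>P. partition_on (pverts D) P \<and> finite P \<and> card P \<le> k \<and>
      (\<forall>X \<in> P. acyclic_digraph (with_proj D \<restriction> X))) \<longleftrightarrow>
    (\<exists>\<phi> :: 'a \<Rightarrow> nat. card (\<phi> ` pverts D) \<le> k \<and>
      (\<forall>c. acyclic (parcs D \<inter> {v \<in> pverts D. \<phi> v = c} \<times> {v \<in> pverts D. \<phi> v = c})))"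
  (is "?L \<longleftrightarrow> ?R")
proof
  assume ?L
  then obtain P where P: "partition_on (pverts D) P" "finite P" "card P \<le> k"
    "\<And>X. X \<in> P \<Longrightarrow> acyclic (parcs D \<inter> X \<times> X)"
    by (auto simp: acyclic_digraph_restrict_iff)
  \<comment> \<open>Parts are named by numbers: the colour of a vertex is the code of its
    part.\<close>
  obtain e :: "'a set \<Rightarrow> nat" where e: "inj_on e P"
    using P(2) by (meson finite_imp_inj_to_nat_seg)
  define part where "part v = (THE X. X \<in> P \<and> v \<in> X)" for v
  have part: "part v = X" if "X \<in> P" "v \<in> X" for v X
    unfolding part_def
  proof (rule the_equality)
    show "Y = X" if "Y \<in> P \<and> v \<in> Y" for Y
      using that \<open>X \<in> P\<close> \<open>v \<in> X\<close> partition_onD2[OF P(1)] by (auto simp: disjoint_def)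
  qed (use that in simp)
  have part_in: "part v \<in> P" "v \<in> part v" if "v \<in> pverts D" for v
    using that part partition_onD1[OF P(1)] by auto
  let ?\<phi> = "\<lambda>v. e (part v)"
  have "card (?\<phi> ` pverts D) \<le> card (e ` P)"
    using part_in P(2) by (intro card_mono) auto
  also have "\<dots> \<le> k" using P(3) card_image_le[OF P(2), of e] by linarith
  finally have 1: "card (?\<phi> ` pverts D) \<le> k" .
  have "acyclic (parcs D \<inter> {v \<in> pverts D. ?\<phi> v = c} \<times> {v \<in> pverts D. ?\<phi> v = c})" for c
  proof (cases "\<exists>u \<in> pverts D. ?\<phi> u = c")
    case True
    then obtain u where u: "u \<in> pverts D" "?\<phi> u = c" by blast
    have "{v \<in> pverts D. ?\<phi> v = c} \<subseteq> part u"
    proof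
      fix v assume v: "v \<in> {v \<in> pverts D. ?\<phi> v = c}"
      then have "part v = part u" using u part_in(1) e by (auto dest: inj_onD)
      then show "v \<in> part u" using v part_in(2)[of v] by auto
    qed
    then show ?thesis using P(4)[OF part_in(1)[OF u(1)]] by (auto intro: acyclic_subset)
  next
    case False
    then have "{v \<in> pverts D. ?\<phi> v = c} = {}" by blast
    then show ?thesis by (simp only: Sigma_empty1 Int_empty_right) (simp add: acyclic_def)
  qed
  then show ?R using 1 by blast
next
  assume ?R
  then obtain \<phi> :: "'a \<Rightarrow> nat" where \<phi>: "card (\<phi> ` pverts D) \<le> k"
    "\<And>c. acyclic (parcs D \<inter> {v \<in> pverts D. \<phi> v = c} \<times> {v \<in> pverts D. \<phi> v = c})" by blast
  let ?P = "(\<lambda>c. {v \<in> pverts D. \<phi> v = c}) ` \<phi> ` pverts D"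
  have "partition_on (pverts D) ?P"
    by (auto simp: partition_on_def disjoint_def)
  moreover have "card ?P \<le> k"
    using \<phi>(1) card_image_le[of "\<phi> ` pverts D" "\<lambda>c. {v \<in> pverts D. \<phi> v = c}"] assms
    by (meson finite_imageI order_trans)
  ultimately show ?L
    using \<phi>(2) assms by (intro exI[of _ ?P]) (auto simp: acyclic_digraph_restrict_iff)
qed

lemma dichromatic_number_le_iff:
  fixes D :: "'a pair_pre_digraph"
  assumes "pair_digraph D"
  shows "dichromatic_number D \<le> k \<longleftrightarrow>
    (\<exists>\<phi> :: 'a \<Rightarrow> nat. card (\<phi> ` pverts D) \<le> k \<and>
      (\<forall>c. acyclic (parcs D \<inter> {v \<in> pverts D. \<phi> v = c} \<times> {v \<in> pverts D. \<phi> v = c})))"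
proof -
  interpret pair_digraph D by fact
  let ?Q = "\<lambda>P. partition_on (pverts D) P \<and> finite P \<and>
    (\<forall>X \<in> P. acyclic_digraph (with_proj D \<restriction> X))"
  have "parcs D \<inter> {x} \<times> {x} = {}" for x using no_loops' by auto
  then have "?Q ((\<lambda>x. {x}) ` pverts D)"
    using pair_finite_verts
    by (auto simp: partition_on_def disjoint_def acyclic_digraph_restrict_iff acyclic_def)
  then have "\<exists>k P. partition_on (pverts D) P \<and> finite P \<and> card P = k \<and>
      (\<forall>X \<in> P. acyclic_digraph (with_proj D \<restriction> X))" by blast
  from LeastI_ex[OF this] have "\<exists>P. ?Q P \<and> card P = dichromatic_number D"
    unfolding dichromatic_number_def by blast
  moreover have "dichromatic_number D \<le> card P" if "?Q P" for P
    unfolding dichromatic_number_def using that by (intro Least_le) auto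
  ultimately have "dichromatic_number D \<le> k \<longleftrightarrow> (\<exists>P. ?Q P \<and> card P \<le> k)"
    by (metis order_trans order_refl)
  then show ?thesis
    unfolding partition_acyclic_iff_colouring[OF pair_finite_verts, symmetric] by blast
qed

section \<open>Elimination orders and the greedy colouring\<close>

definition clique :: "'a rel \<Rightarrow> 'a set \<Rightarrow> bool" where
  "clique R K \<longleftrightarrow> (\<forall>u\<in>K. \<forall>v\<in>K. u \<noteq> v \<longrightarrow> (u, v) \<in> R \<or> (v, u) \<in> R)"

definition three_cycle :: "'a rel \<Rightarrow> 'a \<Rightarrow> 'a \<Rightarrow> 'a \<Rightarrow> bool" where
  "three_cycle R a b c \<longleftrightarrow> (a, b) \<in> R \<and> (b, c) \<in> R \<and> (c, a) \<in> R"

abbreviation trans_list :: "'a rel \<Rightarrow> 'a list \<Rightarrow> bool" where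
  "trans_list R \<equiv> sorted_wrt (\<lambda>a b. (a, b) \<in> R)"

text \<open>\<open>A\<close> and \<open>B\<close> are the out- and in-neighbours of \<open>x\<close>
  among the vertices present when it is added. Their disjointness excludes digons, so one relation
  carries the chordal graph together with its orientation.\<close>

inductive peo :: "'a set \<Rightarrow> 'a rel \<Rightarrow> bool" where
  empty: "peo {} {}"
| insert: "peo V R \<Longrightarrow> x \<notin> V \<Longrightarrow> A \<subseteq> V \<Longrightarrow> B \<subseteq> V \<Longrightarrow> A \<inter> B = {} \<Longrightarrow> clique R (A \<union> B) \<Longrightarrow>
    peo (insert x V) (R \<union> {x} \<times> A \<union> B \<times> {x})"

lemma clique_subset: "clique R K \<Longrightarrow> L \<subseteq> K \<Longrightarrow> clique R L"
  unfolding clique_def by blast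

lemma clique_mono: "clique R K \<Longrightarrow> R \<subseteq> Q \<Longrightarrow> clique Q K"
  unfolding clique_def by blast

lemma peo_finite: "peo V R \<Longrightarrow> finite V"
  by (induction rule: peo.induct) auto

lemma peo_subset: "peo V R \<Longrightarrow> R \<subseteq> V \<times> V"
  by (induction rule: peo.induct) auto

lemma peo_asym: "peo V R \<Longrightarrow> (a, b) \<in> R \<Longrightarrow> (b, a) \<notin> R"
proof (induction arbitrary: a b rule: peo.induct)
  case (insert V R x A B)
  then show ?case using peo_subset[OF insert(1)] by auto
qed simp

lemma peo_irrefl: "peo V R \<Longrightarrow> (a, a) \<notin> R"
  using peo_asym[of V R a a] by blast

text \<open>A triangle through \<open>x\<close> leaves it into \<open>A\<close> and returns from
  \<open>B\<close>. The set equation avoids distinguishing the three rotations.\<close>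

lemma three_cycle_insert:
  assumes "three_cycle (R \<union> {x} \<times> A \<union> B \<times> {x}) p q r" "R \<subseteq> V \<times> V" "x \<notin> V" "A \<subseteq> V" "B \<subseteq> V"
    "A \<inter> B = {}"
  shows "three_cycle R p q r \<or> (\<exists>a\<in>A. \<exists>b\<in>B. (a, b) \<in> R \<and> {p, q, r} = {x, a, b})"
proof -
  let ?R' = "R \<union> {x} \<times> A \<union> B \<times> {x}"
  have x: "(x, u) \<notin> R" "(u, x) \<notin> R" "x \<notin> A" "x \<notin> B" for u
    using assms(2-5) by auto
  have out: "v \<in> A" if "(x, v) \<in> ?R'" for v using that x by auto
  have inn: "v \<in> B" if "(v, x) \<in> ?R'" for v using that x by auto
  have old: "(u, v) \<in> R" if "(u, v) \<in> ?R'" "u \<noteq> x" "v \<noteq> x" for u v using that by auto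
  have key: "\<exists>a\<in>A. \<exists>b\<in>B. (a, b) \<in> R \<and> {x, v, w} = {x, a, b}"
    if "(x, v) \<in> ?R'" "(v, w) \<in> ?R'" "(w, x) \<in> ?R'" for v w
    using out[OF that(1)] inn[OF that(3)] old[OF that(2)] x by blast
  have t: "(p, q) \<in> ?R'" "(q, r) \<in> ?R'" "(r, p) \<in> ?R'"
    using assms(1) by (auto simp: three_cycle_def)
  consider "p = x" | "q = x" | "r = x" | "p \<noteq> x" "q \<noteq> x" "r \<noteq> x" by blast
  then show ?thesis
  proof cases
    case 1 then show ?thesis using key t by blast
  next
    case 2
    moreover have "{p, q, r} = {q, r, p}" by blast
    ultimately show ?thesis using key[of r p] t by simp
  next
    case 3
    moreover have "{p, q, r} = {r, p, q}" by blast
    ultimately show ?thesis using key[of p q] t by simp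
  next
    case 4 then show ?thesis using old t by (auto simp: three_cycle_def)
  qed
qed

text \<open>Without triangles in \<open>X\<close>, the clique of earlier neighbours of
  \<open>x\<close> has all its arcs between \<open>A\<close> and \<open>B\<close> inside
  \<open>X\<close> directed from \<open>B\<close> to \<open>A\<close>. A passage b -> x -> a can
  therefore be replaced by the arc b -> a.\<close>

lemma peo_acyclic:
  assumes "peo V R" "\<And>a b c. a \<in> X \<Longrightarrow> b \<in> X \<Longrightarrow> c \<in> X \<Longrightarrow> \<not> three_cycle R a b c"
  shows "acyclic (R \<inter> X \<times> X)"
  using assms
proof (induction rule: peo.induct)
  case empty
  then show ?case by (simp add: acyclic_def)
next
  case (insert V R x A B)
  let ?R' = "R \<union> {x} \<times> A \<union> B \<times> {x}"
  note sub = peo_subset[OF insert(1)]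
  have IH: "acyclic (R \<inter> X \<times> X)"
  proof (rule insert.IH)
    show "\<not> three_cycle R a b c" if "a \<in> X" "b \<in> X" "c \<in> X" for a b c
      using insert.prems[OF that] unfolding three_cycle_def by blast
  qed
  have BA: "(b, a) \<in> R \<inter> X \<times> X" if "b \<in> B \<inter> X" "a \<in> A \<inter> X" "x \<in> X" for a b
  proof -
    have "\<not> three_cycle ?R' x a b" using insert.prems that by blast
    then have "(a, b) \<notin> R" using that by (auto simp: three_cycle_def)
    moreover have "a \<noteq> b" using that insert.hyps by auto
    ultimately show ?thesis using insert.hyps(6) that by (auto simp: clique_def)
  qed
  \<comment> \<open>Walks are tracked with every inner visit to \<open>x\<close> bypassed. Only an
    end at \<open>x\<close> remains visible, recorded by the old walk that follows or precedes it;
    no walk leads from \<open>x\<close> to \<open>x\<close>.\<close>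
  have claim: "u = x \<and> v \<noteq> x \<and> x \<in> X \<and> (\<exists>a\<in>A \<inter> X. (a, v) \<in> (R \<inter> X \<times> X)\<^sup>*) \<or>
      v = x \<and> u \<noteq> x \<and> x \<in> X \<and> (\<exists>b\<in>B \<inter> X. (u, b) \<in> (R \<inter> X \<times> X)\<^sup>*) \<or>
      u \<noteq> x \<and> v \<noteq> x \<and> (u, v) \<in> (R \<inter> X \<times> X)\<^sup>+" if "(u, v) \<in> (?R' \<inter> X \<times> X)\<^sup>+" for u v
    using that
  proof (induction rule: trancl.induct)
    case (r_into_trancl u v)
    then show ?case using insert.hyps sub by auto
  next
    case (trancl_into_trancl u v w)
    from trancl_into_trancl.IH consider
      (out) a where "u = x" "v \<noteq> x" "x \<in> X" "a \<in> A \<inter> X" "(a, v) \<in> (R \<inter> X \<times> X)\<^sup>*"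
    | (inn) b where "v = x" "u \<noteq> x" "x \<in> X" "b \<in> B \<inter> X" "(u, b) \<in> (R \<inter> X \<times> X)\<^sup>*"
    | (old) "u \<noteq> x" "v \<noteq> x" "(u, v) \<in> (R \<inter> X \<times> X)\<^sup>+" by blast
    then show ?case
    proof cases
      case out
      \<comment> \<open>Coming back to \<open>x\<close> would close an old cycle through the bypass
        v -> a.\<close>
      have "w \<noteq> x"
      proof
        assume "w = x"
        then have "v \<in> B \<inter> X" using trancl_into_trancl.hyps(2) out sub insert.hyps by auto
        then have "(v, a) \<in> R \<inter> X \<times> X" using BA out by blast
        then have "(v, v) \<in> (R \<inter> X \<times> X)\<^sup>+" using out(5) by (metis rtrancl_into_trancl2)
        then show False using IH by (auto simp: acyclic_def)
      qed
      then have "(v, w) \<in> R \<inter> X \<times> X" using trancl_into_trancl.hyps(2) out by auto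
      then show ?thesis using out \<open>w \<noteq> x\<close> by (meson rtrancl.rtrancl_into_rtrancl)
    next
      case inn
      then have w: "w \<in> A \<inter> X"
        using trancl_into_trancl.hyps(2) sub insert.hyps by auto
      then have "(b, w) \<in> R \<inter> X \<times> X" using BA inn by blast
      then have "(u, w) \<in> (R \<inter> X \<times> X)\<^sup>+" using inn by (meson rtrancl_into_trancl1)
      then show ?thesis using inn w insert.hyps by auto
    next
      case old
      then have "u \<in> V" using sub by (metis (no_types, lifting) Int_iff SigmaD1 subsetD tranclD)
      show ?thesis
      proof (cases "w = x")
        case True
        then have "v \<in> B \<inter> X" "x \<in> X" using trancl_into_trancl.hyps(2) old sub insert.hyps by auto
        then show ?thesis using old True by (meson trancl_into_rtrancl)
      next
        case False
        then have "(v, w) \<in> R \<inter> X \<times> X" using trancl_into_trancl.hyps(2) old by auto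
        then show ?thesis using old False trancl.trancl_into_trancl[OF old(3)] by blast
      qed
    qed
  qed
  show ?case
    unfolding acyclic_def
  proof (intro allI notI)
    fix u assume "(u, u) \<in> (?R' \<inter> X \<times> X)\<^sup>+"
    from claim[OF this] IH show False by (auto simp: acyclic_def)
  qed
qed

lemma trans_list_distinct:
  assumes "trans_list R xs" "\<And>a. (a, a) \<notin> R"
  shows "distinct xs"
  using assms by (induction xs) auto

section \<open>Transitive subtournaments of cliques\<close>

lemma acyclic_clique_trans_list:
  assumes "finite Y" "clique R Y" "acyclic (R \<inter> Y \<times> Y)"
  shows "\<exists>xs. set xs = Y \<and> distinct xs \<and> trans_list R xs"
  using assms
proof (induction "card Y" arbitrary: Y)
  case 0
  then show ?case by (intro exI[of _ "[]"]) auto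
next
  case (Suc n)
  have "finite (R \<inter> Y \<times> Y)" using Suc.prems by blast
  then have "wf (R \<inter> Y \<times> Y)" using Suc.prems finite_acyclic_wf by blast
  moreover have "Y \<noteq> {}" using Suc by auto
  ultimately obtain m where m: "m \<in> Y" "\<And>y. (y, m) \<in> R \<inter> Y \<times> Y \<Longrightarrow> y \<notin> Y"
    by (metis all_not_in_conv wfE_min)
  have "\<exists>xs. set xs = Y - {m} \<and> distinct xs \<and> trans_list R xs"
  proof (rule Suc.hyps(1))
    show "clique R (Y - {m})" using Suc.prems by (auto intro: clique_subset)
    show "acyclic (R \<inter> (Y - {m}) \<times> (Y - {m}))"
      using Suc.prems(3) by (rule acyclic_subset) auto
    show "n = card (Y - {m})" using Suc.hyps(2) m(1) Suc.prems(1) by simp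
    show "finite (Y - {m})" using Suc.prems(1) by simp
  qed
  then obtain xs where xs: "set xs = Y - {m}" "distinct xs" "trans_list R xs" by blast
  have "(m, y) \<in> R" if "y \<in> set xs" for y
    using that m xs(1) Suc.prems(2) unfolding clique_def by blast
  then show ?case using m(1) xs by (intro exI[of _ "m # xs"]) auto
qed

text \<open>The Erdos-Moser argument: the out- and in-neighbours of \<open>v\<close> cover the at
  least 2 * 2^k - 1 other vertices, so one of the two sets has 2^k elements; \<open>v\<close> goes
  in front of its out-neighbours or behind its in-neighbours.\<close>

lemma clique_trans_list:
  assumes "finite K" "clique R K" "2 ^ k \<le> card K"
  shows "\<exists>xs. length xs = k \<and> set xs \<subseteq> K \<and> trans_list R xs"
  using assms
proof (induction k arbitrary: K)
  case 0
  then show ?case by (intro exI[of _ "[]"]) auto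
next
  case (Suc k)
  have "K \<noteq> {}" using Suc.prems(3) by auto
  then obtain v where v: "v \<in> K" by blast
  define Out where "Out = {w \<in> K - {v}. (v, w) \<in> R}"
  define In where "In = {w \<in> K - {v}. (w, v) \<in> R}"
  have sub: "Out \<subseteq> K" "In \<subseteq> K" by (auto simp: Out_def In_def)
  have fin: "finite Out" "finite In" using sub Suc.prems(1) by (auto intro: finite_subset)
  have "K - {v} \<subseteq> Out \<union> In" using Suc.prems(2) v by (auto simp: clique_def Out_def In_def)
  then have "card (K - {v}) \<le> card Out + card In"
    by (meson fin card_Un_le card_mono finite_UnI le_trans)
  moreover have "card (K - {v}) = card K - 1" using v Suc.prems(1) by simp
  moreover have "2 * 2 ^ k \<le> card K" using Suc.prems by simp
  ultimately consider "2 ^ k \<le> card Out" | "2 ^ k \<le> card In" by linarith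
  then show ?case
  proof cases
    case 1
    then obtain xs where "length xs = k" "set xs \<subseteq> Out" "trans_list R xs"
      using Suc.IH[OF fin(1) clique_subset[OF Suc.prems(2) sub(1)]] by blast
    then show ?thesis using v by (intro exI[of _ "v # xs"]) (auto simp: Out_def)
  next
    case 2
    then obtain xs where "length xs = k" "set xs \<subseteq> In" "trans_list R xs"
      using Suc.IH[OF fin(2) clique_subset[OF Suc.prems(2) sub(2)]] by blast
    then show ?thesis
      using v by (intro exI[of _ "xs @ [v]"]) (auto simp: In_def sorted_wrt_append)
  qed
qed

text \<open>\<open>fan_free k\<close> excludes $\vec{C}_3(1,1,k)$ with parts \<open>u\<close>, \<open>v\<close> and \<open>xs\<close>.\<close>

definition fan_free :: "nat \<Rightarrow> 'a rel \<Rightarrow> bool" where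
  "fan_free k R \<longleftrightarrow> \<not> (\<exists>u v xs. (u, v) \<in> R \<and> length xs = k \<and> trans_list R xs \<and>
    (\<forall>y\<in>set xs. (v, y) \<in> R \<and> (y, u) \<in> R))"

lemma fan_free_card:
  assumes "fan_free k R" "(u, v) \<in> R" "finite Y" "clique R Y"
    and "\<And>y. y \<in> Y \<Longrightarrow> (v, y) \<in> R \<and> (y, u) \<in> R"
  shows "card Y < 2 ^ k"
proof (rule ccontr)
  assume "\<not> ?thesis"
  then obtain xs where "length xs = k" "set xs \<subseteq> Y" "trans_list R xs"
    using clique_trans_list[OF assms(3,4)] by (meson not_less)
  moreover from this have "\<forall>y\<in>set xs. (v, y) \<in> R \<and> (y, u) \<in> R" using assms(5) by blast
  ultimately show False using assms(1,2) unfolding fan_free_def by blast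
qed

text \<open>The tails of \<open>M\<close> lie in a clique and would contain a transitive list of 2 *
  2^k + 1 vertices. Let \<open>a\<close> be its last vertex and a -> b its arc in \<open>M\<close>.
  A preceding y with y -> b forms a triangle with the arc b -> x, and one with b -> y forms a
  triangle with a -> b. Vertices of each kind form a clique, so there are fewer than 2^k of
  each.\<close>

lemma fan_free_matching:
  assumes ff: "fan_free k R" and irr: "\<And>a. (a, a) \<notin> R"
    and AB: "clique R (A \<union> B)" "A \<inter> B = {}" "finite A"
    and x: "\<And>a. a \<in> A \<Longrightarrow> (x, a) \<in> R" "\<And>b. b \<in> B \<Longrightarrow> (b, x) \<in> R"
    and M: "M \<subseteq> R \<inter> A \<times> B" "inj_on fst M"
  shows "card M < 2 ^ (2 * 2 ^ k + 1)"
proof (rule ccontr)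
  assume "\<not> ?thesis"
  then have "2 ^ (2 * 2 ^ k + 1) \<le> card (fst ` M)" using M(2) by (simp add: card_image)
  moreover have fM: "fst ` M \<subseteq> A" using M(1) by auto
  ultimately obtain xs where xs: "length xs = 2 * 2 ^ k + 1" "set xs \<subseteq> fst ` M" "trans_list R xs"
    using clique_trans_list[of "fst ` M" R] AB clique_subset[OF AB(1), of "fst ` M"]
    by (metis finite_subset le_supI1)
  define ys a where "ys = butlast xs" and "a = last xs"
  have xs_eq: "xs = ys @ [a]"
    unfolding ys_def a_def using xs(1) by (intro append_butlast_last_id[symmetric]) auto
  have ys: "set ys \<subseteq> A" "card (set ys) = 2 * 2 ^ k" "\<And>y. y \<in> set ys \<Longrightarrow> (y, a) \<in> R"
    using xs fM trans_list_distinct[OF xs(3) irr]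
    by (auto simp: xs_eq sorted_wrt_append distinct_card)
  obtain e where e: "e \<in> M" "fst e = a" using xs(2) by (auto simp: xs_eq)
  then obtain b where ab: "(a, b) \<in> R" "a \<in> A" "b \<in> B" using M(1) by (cases e) auto
  define Y1 Y2 where "Y1 = {y \<in> set ys. (y, b) \<in> R}" and "Y2 = {y \<in> set ys. (b, y) \<in> R}"
  have "set ys \<subseteq> Y1 \<union> Y2"
  proof
    fix y assume y: "y \<in> set ys"
    then have "y \<in> A" "y \<noteq> b" using ys(1) ab AB(2) by auto
    then have "(y, b) \<in> R \<or> (b, y) \<in> R" using AB(1) ab(3) unfolding clique_def by blast
    then show "y \<in> Y1 \<union> Y2" using y by (auto simp: Y1_def Y2_def)
  qed
  then have "card (set ys) \<le> card Y1 + card Y2"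
    by (intro order_trans[OF card_mono card_Un_le]) (simp_all add: Y1_def Y2_def)
  moreover have cl: "clique R Y1" "clique R Y2" "finite Y1" "finite Y2"
    using ys(1) by (auto simp: Y1_def Y2_def intro!: clique_subset[OF AB(1)])
  moreover have "card Y1 < 2 ^ k"
    using ab ys(1) x by (intro fan_free_card[OF ff _ cl(3,1), of b x]) (auto simp: Y1_def)
  moreover have "card Y2 < 2 ^ k"
    using ab ys(3) by (intro fan_free_card[OF ff ab(1) cl(4,2)]) (auto simp: Y2_def)
  ultimately show False using ys(2) by linarith
qed

lemma fan_free_colouring:
  fixes V :: "'a set"
  assumes "peo V R" "fan_free k R"
  shows "\<exists>\<phi> :: 'a \<Rightarrow> nat. \<phi> ` V \<subseteq> {..<2 ^ (2 * 2 ^ k + 2)} \<and>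
    (\<forall>a b c. three_cycle R a b c \<longrightarrow> \<not> (\<phi> a = \<phi> b \<and> \<phi> b = \<phi> c))"
  using assms
proof (induction rule: peo.induct)
  case empty
  then show ?case by (auto simp: three_cycle_def)
next
  case (insert V R x A B)
  let ?R' = "R \<union> {x} \<times> A \<union> B \<times> {x}"
  let ?N = "2 ^ (2 * 2 ^ k + 2) :: nat"
  have "fan_free k R"
    unfolding fan_free_def
  proof (intro notI, elim exE conjE)
    fix u v xs
    assume "(u, v) \<in> R" "length xs = k" "trans_list R xs" "\<forall>y\<in>set xs. (v, y) \<in> R \<and> (y, u) \<in> R"
    moreover from this have "trans_list ?R' xs"
      by (elim sorted_wrt_mono_rel[rotated]) simp
    ultimately have "(u, v) \<in> ?R' \<and> length xs = k \<and> trans_list ?R' xs \<and>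
      (\<forall>y\<in>set xs. (v, y) \<in> ?R' \<and> (y, u) \<in> ?R')" by simp
    then show False using insert.prems unfolding fan_free_def by blast
  qed
  then obtain \<phi> :: "'a \<Rightarrow> nat" where \<phi>: "\<phi> ` V \<subseteq> {..<?N}"
    "\<And>a b c. three_cycle R a b c \<Longrightarrow> \<not> (\<phi> a = \<phi> b \<and> \<phi> b = \<phi> c)"
    using insert.IH by blast
  have fin: "finite V" "finite A" "finite B"
    using peo_finite[OF insert.hyps(1)] insert.hyps by (auto intro: finite_subset)
  have peo': "peo (insert x V) ?R'" using insert.hyps by (rule peo.insert)
  define bad where "bad = R \<inter> A \<times> B"
  define Ms where "Ms = {M. M \<subseteq> bad \<and> inj_on fst M \<and> inj_on snd M}"
  have "finite bad" using fin by (simp add: bad_def)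
  then have "finite Ms" unfolding Ms_def by simp
  moreover have "{} \<in> Ms" by (simp add: Ms_def)
  ultimately have "Max (card ` Ms) \<in> card ` Ms" by (intro Max_in) auto
  then obtain M where M: "M \<in> Ms" "card M = Max (card ` Ms)" by auto
  have M_max: "card M' \<le> card M" if "M' \<in> Ms" for M'
    unfolding M(2) using \<open>finite Ms\<close> that by (intro Max_ge) auto
  have finM: "finite M" using M(1) \<open>finite bad\<close> by (auto simp: Ms_def intro: finite_subset)
  have "card M < 2 ^ (2 * 2 ^ k + 1)"
  proof (rule fan_free_matching[OF insert.prems peo_irrefl[OF peo']])
    show "clique ?R' (A \<union> B)" using insert.hyps(6) by (rule clique_mono) auto
  qed (use M(1) fin insert.hyps in \<open>auto simp: Ms_def bad_def\<close>)
  define S where "S = fst ` M \<union> snd ` M"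
  have "card S \<le> card M + card M"
    unfolding S_def using card_Un_le card_image_le[OF finM] by (meson add_mono le_trans)
  \<comment> \<open>The number of colours is twice the bound for the matching, so some colour is
    absent from the matching ends.\<close>
  then have "card (\<phi> ` S) < ?N"
    using \<open>card M < _\<close> card_image_le[of S \<phi>] finM by (simp add: S_def)
  then have "\<not> {..<?N} \<subseteq> \<phi> ` S"
    using card_mono[of "\<phi> ` S" "{..<?N}"] finM by (auto simp: S_def)
  then obtain i where i: "i < ?N" "i \<notin> \<phi> ` S" by blast
  \<comment> \<open>An arc with both ends outside \<open>S\<close> would enlarge the maximum
    matching.\<close>
  have cover: "a \<in> S \<or> b \<in> S" if "a \<in> A" "b \<in> B" "(a, b) \<in> R" for a b
  proof (rule ccontr)
    assume n: "\<not> ?thesis"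
    then have "a \<notin> fst ` M" "b \<notin> snd ` M" by (auto simp: S_def)
    then have "(a, b) \<notin> M" "insert (a, b) M \<in> Ms"
      using M(1) that by (force, simp add: Ms_def bad_def inj_on_insert Diff_insert_absorb image_iff)
    then show False using M_max[of "insert (a, b) M"] finM by simp
  qed
  show ?case
  proof (intro exI[of _ "\<phi>(x := i)"] conjI allI impI)
    show "\<phi>(x := i) ` insert x V \<subseteq> {..<?N}" using \<phi>(1) i(1) insert.hyps(2) by auto
  next
    fix a b c assume t: "three_cycle ?R' a b c"
    show "\<not> ((\<phi>(x := i)) a = (\<phi>(x := i)) b \<and> (\<phi>(x := i)) b = (\<phi>(x := i)) c)"
      using three_cycle_insert[OF t peo_subset[OF insert.hyps(1)] insert.hyps(2-5)]
    proof (elim disjE bexE conjE)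
      assume t: "three_cycle R a b c"
      then have "x \<notin> {a, b, c}"
        using peo_subset[OF insert.hyps(1)] insert.hyps(2) by (auto simp: three_cycle_def)
      then show ?thesis using \<phi>(2)[OF t] by auto
    next
      fix p q assume pq: "p \<in> A" "q \<in> B" "(p, q) \<in> R" "{a, b, c} = {x, p, q}"
      have "\<phi> p \<noteq> i \<or> \<phi> q \<noteq> i" using cover[OF pq(1-3)] i(2) by (auto simp: image_iff)
      moreover have "p \<noteq> x" "q \<noteq> x" using pq insert.hyps by auto
      ultimately have "\<not> (\<forall>y\<in>{x, p, q}. \<forall>z\<in>{x, p, q}. (\<phi>(x := i)) y = (\<phi>(x := i)) z)"
        by auto
      then show ?thesis unfolding pq(4)[symmetric] by auto
    qed
  qed
qed

section \<open>Chordal graphs and elimination orders\<close>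

lemma pawalk_verts_conv:
  assumes "pcas u p v"
  shows "pawalk_verts u p = u # map snd p" "pawalk_verts u p = map fst p @ [v]"
  using assms by (induction p arbitrary: u) auto

text \<open>The vertex list of a closed walk is \<open>u\<close> followed by the heads as well as
  the tails followed by \<open>u\<close>, so heads and tails form the same multiset.\<close>

lemma closed_pcas_distinct_iff:
  assumes "pcas u p u"
  shows "distinct (tl (pawalk_verts u p)) \<longleftrightarrow> distinct (map fst p)"
    and "distinct (map snd p) \<longleftrightarrow> distinct (map fst p)"
    and "snd ` set p = fst ` set p"
proof -
  have "mset (u # map snd p) = mset (map fst p @ [u])"
    using pawalk_verts_conv[OF assms] by simp
  then have m: "mset (map snd p) = mset (map fst p)" by simp
  then show "distinct (map snd p) \<longleftrightarrow> distinct (map fst p)" by (metis mset_eq_imp_distinct_iff)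
  then show "distinct (tl (pawalk_verts u p)) \<longleftrightarrow> distinct (map fst p)"
    by (simp add: pawalk_verts_conv(1)[OF assms])
  show "snd ` set p = fst ` set p" using mset_eq_setD[OF m] by simp
qed

text \<open>For a set \<open>T\<close> closed under the arcs of a closed walk, the two parts
  together confine the walk to \<open>T\<close> once it meets \<open>T\<close>.\<close>

lemma pcas_trapped:
  assumes "pcas u p w" "\<And>a b. (a, b) \<in> set p \<Longrightarrow> a \<in> T \<Longrightarrow> b \<in> T"
  shows "u \<in> T \<Longrightarrow> fst ` set p \<subseteq> T \<and> w \<in> T" "fst ` set p \<inter> T \<noteq> {} \<Longrightarrow> w \<in> T"
proof -
  have 1: "fst ` set p \<subseteq> T \<and> w \<in> T" if "pcas u p w" "u \<in> T"
    "\<And>a b. (a, b) \<in> set p \<Longrightarrow> a \<in> T \<Longrightarrow> b \<in> T" for u p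
    using that
  proof (induction p arbitrary: u)
    case (Cons e p)
    have "fst ` set p \<subseteq> T \<and> w \<in> T"
    proof (rule Cons.IH)
      show "pcas (snd e) p w" using Cons.prems(1) by simp
      show "snd e \<in> T" using Cons.prems by (cases e) auto
    qed (use Cons.prems(3) in auto)
    then show ?case using Cons.prems(1,2) by simp
  qed simp
  show "u \<in> T \<Longrightarrow> fst ` set p \<subseteq> T \<and> w \<in> T" using 1 assms by blast
  show "fst ` set p \<inter> T \<noteq> {} \<Longrightarrow> w \<in> T"
    using assms
  proof (induction p arbitrary: u)
    case (Cons e p)
    show ?case
    proof (cases "u \<in> T")
      case True
      then show ?thesis using 1[OF Cons.prems(2) True] Cons.prems(3) by blast
    next
      case False
      then have "fst ` set p \<inter> T \<noteq> {}" using Cons.prems(1,2) by auto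
      moreover have "pcas (snd e) p w" using Cons.prems(2) by simp
      ultimately show ?thesis using Cons.IH Cons.prems(3) by (meson list.set_intros(2))
    qed
  qed simp
qed

text \<open>The last inserted vertex of the cycle has both its neighbours on the cycle in one
  clique, so they are joined; length at least 4 makes this edge a chord.\<close>

lemma peo_cycle_chord:
  assumes "peo V R" "set p \<subseteq> R \<union> R\<inverse>" "pcas u p u" "distinct (map fst p)" "4 \<le> length p"
  shows "\<exists>s\<in>fst ` set p. \<exists>t\<in>fst ` set p. (s, t) \<in> R \<union> R\<inverse> \<and> (s, t) \<notin> set p \<and> (t, s) \<notin> set p"
  using assms(1,2)
proof (induction rule: peo.induct)
  case empty
  then show ?case using assms(5) by auto
next
  case (insert V R x A B)
  let ?R' = "R \<union> {x} \<times> A \<union> B \<times> {x}"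
  have xV: "u \<noteq> x" "v \<noteq> x" if "(u, v) \<in> R" for u v
    using that peo_subset[OF insert.hyps(1)] insert.hyps(2) by auto
  have uniq: "b = b'" if "(a, b) \<in> set p" "(a, b') \<in> set p" for a b b'
    using assms(4) that by (rule eq_key_imp_eq_value)
  note ends = closed_pcas_distinct_iff(3)[OF assms(3)]
  show ?case
  proof (cases "x \<in> fst ` set p")
    case False
    have "e \<in> R \<union> R\<inverse>" if e: "e \<in> set p" for e
    proof -
      have "fst e \<noteq> x" "snd e \<noteq> x" using False ends e by (metis imageI)+
      moreover have "e \<in> ?R' \<union> ?R'\<inverse>" using insert.prems e by blast
      ultimately show ?thesis by auto
    qed
    then have "set p \<subseteq> R \<union> R\<inverse>" by blast
    from insert.IH[OF this] show ?thesis by blast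
  next
    case True
    then obtain t where t: "(x, t) \<in> set p" by auto
    from True obtain s where s: "(s, x) \<in> set p" using ends by (metis imageE prod.collapse)
    have st: "s \<in> A \<union> B" "t \<in> A \<union> B"
      using insert.prems s t xV insert.hyps(2-4) by blast+
    have ne: "s \<noteq> x" "t \<noteq> x" using st insert.hyps(2-4) by blast+
    \<comment> \<open>Otherwise the walk never leaves {x, t, s}, which is too small for at least 4
      distinct tails.\<close>
    have no: "s \<noteq> t \<and> (t, s) \<notin> set p"
    proof (rule ccontr)
      assume a: "\<not> ?thesis"
      let ?T = "{x, t, s}"
      have cl: "b \<in> ?T" if "(a, b) \<in> set p" "a \<in> ?T" for a b
        using a uniq[OF that(1)] that(2) s t by blast
      have "fst ` set p \<inter> ?T \<noteq> {}" using t by force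
      then have "u \<in> ?T" using pcas_trapped(2)[OF assms(3), of ?T] cl by blast
      then have "fst ` set p \<subseteq> ?T" using pcas_trapped(1)[OF assms(3), of ?T] cl by blast
      then have "card (fst ` set p) \<le> card ?T" by (intro card_mono) auto
      moreover have "card ?T \<le> 3" by (simp add: card_insert_if)
      moreover have "card (fst ` set p) = length p"
        using distinct_card[OF assms(4)] by simp
      ultimately show False using assms(5) by simp
    qed
    have "(s, t) \<in> R \<union> R\<inverse>" using insert.hyps(6) st no unfolding clique_def by blast
    moreover have "(s, t) \<notin> set p" using uniq[OF s] ne by blast
    moreover have "s \<in> fst ` set p" "t \<in> fst ` set p" using s t ends by force+
    ultimately show ?thesis using no by blast
  qed
qed

lemma peo_pair_digraph:
  assumes "peo (pverts D) (parcs D)"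
  shows "pair_digraph D"
proof
  fix e assume "e \<in> parcs D"
  then show "fst e \<in> pverts D" "snd e \<in> pverts D" "fst e \<noteq> snd e"
    using peo_subset[OF assms] peo_irrefl[OF assms] by (cases e; auto)+
next
  show "finite (pverts D)" using peo_finite[OF assms] .
  then show "finite (parcs D)" using peo_subset[OF assms] by (meson finite_SigmaI finite_subset)
qed

lemma peo_oriented_chordal:
  assumes "peo (pverts D) (parcs D)"
  shows "oriented_chordal D"
proof -
  let ?G = "\<lparr>pverts = pverts D, parcs = parcs D \<union> (parcs D)\<inverse>\<rparr>"
  interpret pair_digraph D using peo_pair_digraph[OF assms] .
  have "pair_graph ?G"
  proof
    show "symmetric (with_proj ?G)" by (auto simp: symmetric_def sym_def)
  qed (use pair_finite_verts pair_finite_arcs no_loops' in \<open>auto dest: in_arcsD1 in_arcsD2\<close>, blast?)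
  moreover have "has_chord ?G p" if c: "pre_digraph.cycle (with_proj ?G) p" "4 \<le> length p" for p
  proof -
    obtain u where u: "set p \<subseteq> parcs D \<union> (parcs D)\<inverse>" "pcas u p u"
      "distinct (tl (pawalk_verts u p))"
      using c(1) by (auto simp: cycle_with_proj_iff)
    then show ?thesis
      using peo_cycle_chord[OF assms u(1,2) _ c(2)] closed_pcas_distinct_iff(1)[OF u(2)]
      by (simp add: has_chord_def)
  qed
  moreover have "orientation_of D ?G"
    using peo_asym[OF assms] by (auto simp: orientation_of_def)
  ultimately show ?thesis unfolding oriented_chordal_def chordal_graph_def by blast
qed

text \<open>The excluded pair of positions \<open>(0, length xs - 1)\<close> is the closing edge of the cycle.\<close>

definition hole_free :: "'a set \<Rightarrow> 'a rel \<Rightarrow> bool" where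
  "hole_free V E \<longleftrightarrow> (\<forall>xs. set xs \<subseteq> V \<and> distinct xs \<and> 4 \<le> length xs \<and>
    successively (\<lambda>a b. (a, b) \<in> E) xs \<and> (last xs, hd xs) \<in> E \<longrightarrow>
    (\<exists>i j. i + 1 < j \<and> j < length xs \<and> (i, j + 1) \<noteq> (0, length xs) \<and> (xs ! i, xs ! j) \<in> E))"

section \<open>Simplicial vertices of graphs without holes\<close>

lemma hole_freeD:
  assumes "hole_free V E" "set xs \<subseteq> V" "distinct xs" "4 \<le> length xs"
    and "successively (\<lambda>a b. (a, b) \<in> E) xs" "(last xs, hd xs) \<in> E"
  obtains i j where "i + 1 < j" "j < length xs" "(i, j + 1) \<noteq> (0, length xs)" "(xs ! i, xs ! j) \<in> E"
  using assms unfolding hole_free_def by blast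

lemma hole_free_subset: "hole_free V E \<Longrightarrow> W \<subseteq> V \<Longrightarrow> hole_free W E"
  unfolding hole_free_def by blast

lemma hole_free_restrict:
  assumes "hole_free V E"
  shows "hole_free V (E \<inter> V \<times> V)"
  unfolding hole_free_def
proof (intro allI impI, elim conjE)
  fix xs assume a: "set xs \<subseteq> V" "distinct xs" "4 \<le> length xs"
    "successively (\<lambda>a b. (a, b) \<in> E \<inter> V \<times> V) xs" "(last xs, hd xs) \<in> E \<inter> V \<times> V"
  have "successively (\<lambda>a b. (a, b) \<in> E) xs"
    using a(4) by (rule successively_mono) auto
  then obtain i j where "i + 1 < j" "j < length xs" "(i, j + 1) \<noteq> (0, length xs)"
    "(xs ! i, xs ! j) \<in> E"
    using hole_freeD[OF assms a(1-3)] a(5) by auto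
  moreover from this have "xs ! i \<in> V" "xs ! j \<in> V" using a(1) by auto
  ultimately show "\<exists>i j. i + 1 < j \<and> j < length xs \<and> (i, j + 1) \<noteq> (0, length xs) \<and>
    (xs ! i, xs ! j) \<in> E \<inter> V \<times> V" by blast
qed

lemma pcas_zip: "pcas x (zip (x # xs) (xs @ [y])) y"
  by (induction xs arbitrary: x) auto

lemma chordal_graph_hole_free:
  assumes "chordal_graph G"
  shows "hole_free (pverts G) (parcs G)"
  unfolding hole_free_def
proof (intro allI impI, elim conjE)
  fix xs assume a: "set xs \<subseteq> pverts G" "distinct xs" "4 \<le> length xs"
    "successively (\<lambda>a b. (a, b) \<in> parcs G) xs" "(last xs, hd xs) \<in> parcs G"
  interpret pair_graph G using assms by (simp add: chordal_graph_def)
  let ?n = "length xs"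
  \<comment> \<open>Rotating by one pairs every vertex with its cyclic successor.\<close>
  define p where "p = zip xs (rotate1 xs)"
  obtain x ys where xs: "xs = x # ys" using a(3) by (cases xs) auto
  have len: "length p = ?n" by (simp add: p_def)
  have nth: "p ! i = (xs ! i, xs ! (Suc i mod ?n))" if "i < ?n" for i
    using that by (simp add: p_def nth_rotate1)
  have cas: "pcas x p x" using pcas_zip[of x ys x] by (simp add: p_def xs)
  have fst: "map fst p = xs" by (simp add: p_def)
  have "p ! i \<in> parcs G" if "i < ?n" for i
  proof (cases "Suc i = ?n")
    case True
    then have "last xs = xs ! i" "hd xs = xs ! 0" using a(3)
      by (metis Zero_not_Suc diff_Suc_1 last_conv_nth list.size(3)) (simp add: xs)
    then show ?thesis using nth[OF that] True a(5) by simp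
  next
    case False
    then have "Suc i < ?n" using that by simp
    then show ?thesis using nth[OF that] a(4) by (simp add: successively_conv_nth)
  qed
  then have sub: "set p \<subseteq> parcs G" using len by (metis in_set_conv_nth subsetI)
  have "x \<in> pverts G" using a(1) xs by simp
  moreover have "distinct (tl (pawalk_verts x p))"
    using a(2) by (simp add: closed_pcas_distinct_iff(1)[OF cas] fst)
  moreover have "p \<noteq> []" using len a(3) by auto
  ultimately have "pre_digraph.cycle (with_proj G) p"
    unfolding cycle_with_proj_iff using sub cas by blast
  then have "has_chord G p" using assms a(3) len by (simp add: chordal_graph_def)
  then obtain s t where st: "s \<in> set xs" "t \<in> set xs" "(s, t) \<in> parcs G" "(s, t) \<notin> set p"
    "(t, s) \<notin> set p"
    using fst by (metis has_chord_def list.set_map)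
  then obtain i0 j0 where ij0: "i0 < ?n" "j0 < ?n" "xs ! i0 = s" "xs ! j0 = t"
    by (metis in_set_conv_nth)
  have "i0 \<noteq> j0" using ij0 st(3) no_loops' by auto
  \<comment> \<open>The ends of the chord come in no particular order; symmetry lets the smaller
    position stand first.\<close>
  define i j where "i = min i0 j0" and "j = max i0 j0"
  have ij: "i < j" "j < ?n" using ij0 \<open>i0 \<noteq> j0\<close> by (auto simp: i_def j_def)
  have e: "(xs ! i, xs ! j) \<in> parcs G" "(xs ! i, xs ! j) \<notin> set p" "(xs ! j, xs ! i) \<notin> set p"
    using st ij0 arcs_symmetric by (auto simp: i_def j_def min_def max_def)
  have "j \<noteq> i + 1"
  proof
    assume "j = i + 1"
    then have "p ! i = (xs ! i, xs ! j)" using nth[of i] ij by simp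
    then show False using e(2) ij len by (metis less_trans nth_mem)
  qed
  moreover have "(i, j + 1) \<noteq> (0, ?n)"
  proof
    assume "(i, j + 1) = (0, ?n)"
    then have "p ! j = (xs ! j, xs ! i)" using nth[of j] ij by simp
    then show False using e(3) ij len by (metis nth_mem)
  qed
  ultimately show "\<exists>i j. i + 1 < j \<and> j < ?n \<and> (i, j + 1) \<noteq> (0, ?n) \<and> (xs ! i, xs ! j) \<in> parcs G"
    using ij e(1) by (intro exI[of _ i] exI[of _ j]) auto
qed

text \<open>Two nonadjacent members \<open>x\<close> and \<open>y\<close> of the set, a shortest
  path between them through \<open>C\<close>, and \<open>v\<close> would form a hole: a chord of the
  path would shorten it, and \<open>v\<close> has no neighbour in \<open>C\<close>.\<close>

lemma hole_free_separator_clique: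
  assumes hf: "hole_free V E" and "sym E" and irr: "\<And>a. (a, a) \<notin> E"
    and C: "C \<subseteq> V" "v \<notin> C" "\<And>c. c \<in> C \<Longrightarrow> (v, c) \<notin> E"
    and conn: "\<And>a b. a \<in> C \<Longrightarrow> b \<in> C \<Longrightarrow> (a, b) \<in> (E \<inter> C \<times> C)\<^sup>*" and "v \<in> V"
  shows "clique E {y \<in> V. (v, y) \<in> E \<and> (\<exists>c\<in>C. (y, c) \<in> E)}"
  unfolding clique_def
proof (intro ballI impI, rule ccontr)
  fix x y assume "x \<in> {y \<in> V. (v, y) \<in> E \<and> (\<exists>c\<in>C. (y, c) \<in> E)}"
    "y \<in> {y \<in> V. (v, y) \<in> E \<and> (\<exists>c\<in>C. (y, c) \<in> E)}" "x \<noteq> y" "\<not> ((x, y) \<in> E \<or> (y, x) \<in> E)"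
  then obtain cx cy where xy: "x \<in> V" "(v, x) \<in> E" "cx \<in> C" "(x, cx) \<in> E"
    "y \<in> V" "(v, y) \<in> E" "cy \<in> C" "(y, cy) \<in> E" "x \<noteq> y" "(x, y) \<notin> E" by blast
  have symE: "(b, a) \<in> E" if "(a, b) \<in> E" for a b using \<open>sym E\<close> that by (rule symD)
  let ?suc = "successively (\<lambda>a b. (a, b) \<in> E)"
  let ?path = "\<lambda>q. q \<noteq> [] \<and> hd q = x \<and> last q = y \<and> ?suc q \<and> set q \<subseteq> insert x (insert y C)"
  have "\<exists>qs. qs \<noteq> [] \<and> hd qs = x \<and> last qs = b \<and> ?suc qs \<and> set qs \<subseteq> insert x C"
    if "(cx, b) \<in> (E \<inter> C \<times> C)\<^sup>*" for b
    using that
  proof (induction rule: rtrancl_induct)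
    case base
    then show ?case using xy by (intro exI[of _ "[x, cx]"]) auto
  next
    case (step b c)
    then obtain qs where "qs \<noteq> []" "hd qs = x" "last qs = b" "?suc qs" "set qs \<subseteq> insert x C" by blast
    then show ?case
      using step(2) by (intro exI[of _ "qs @ [c]"]) (auto simp: successively_append_iff)
  qed
  then obtain qs where "qs \<noteq> []" "hd qs = x" "last qs = cy" "?suc qs" "set qs \<subseteq> insert x C"
    using conn xy by blast
  moreover have "(cy, y) \<in> E" using xy(8) by (rule symE)
  ultimately have "?path (qs @ [y])" by (auto simp: successively_append_iff)
  then obtain q where q: "?path q" and min: "\<And>q'. ?path q' \<Longrightarrow> length q \<le> length q'"
    using ex_has_least_nat[of ?path "qs @ [y]" length] by fast
  have q_ne: "q \<noteq> []" and q_hd: "hd q = x" and q_last: "last q = y" and q_suc: "?suc q"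
    and q_set: "set q \<subseteq> insert x (insert y C)" using q by auto
  have dist: "distinct q"
  proof (rule ccontr)
    assume "\<not> distinct q"
    then obtain as bs cs z where dec: "q = as @ [z] @ bs @ [z] @ cs"
      using not_distinct_decomp by blast
    have "?path (as @ [z] @ cs)"
      using q_hd q_last q_suc q_set unfolding dec
      by (auto simp: successively_append_iff hd_append last_append successively_Cons split: if_splits)
    then show False using min[of "as @ [z] @ cs"] dec by simp
  qed
  have nochord: False if "i + 1 < j" "j < length q" "(q ! i, q ! j) \<in> E" for i j
  proof -
    let ?q' = "take (Suc i) q @ drop j q"
    have "?suc (take (Suc i) q @ drop (Suc i) q)" "?suc (take j q @ drop j q)" using q_suc by simp_all
    then have "?suc (take (Suc i) q)" "?suc (drop j q)"
      unfolding successively_append_iff by blast+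
    moreover have "last (take (Suc i) q) = q ! i" "hd (drop j q) = q ! j"
      using that by (auto simp: take_Suc_conv_app_nth hd_drop_conv_nth)
    ultimately have "?suc ?q'" using that(3) by (simp add: successively_append_iff)
    moreover have "hd ?q' = x" "last ?q' = y" "?q' \<noteq> []"
      using that q_ne q_hd q_last by (auto simp: hd_append take_Suc)
    moreover have "set ?q' \<subseteq> insert x (insert y C)"
      using q_set set_take_subset[of "Suc i" q] set_drop_subset[of j q] by auto
    ultimately have "?path ?q'" by blast
    from min[OF this] show False using that by simp
  qed
  have len: "3 \<le> length q"
  proof (rule ccontr)
    assume "\<not> 3 \<le> length q"
    then consider a where "q = [a]" | a b where "q = [a, b]"
      using q_ne by (cases q; cases "tl q"; cases "tl (tl q)") auto
    then show False using q_hd q_last q_suc xy by cases auto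
  qed
  have vq: "v \<notin> set q" using q_set C(2) xy irr by auto
  have "set (v # q) \<subseteq> V" using q_set xy C(1) \<open>v \<in> V\<close> by auto
  moreover have "distinct (v # q)" using dist vq by simp
  moreover have "4 \<le> length (v # q)" using len by simp
  moreover have "?suc (v # q)" using q_suc q_hd q_ne xy by (auto simp: successively_Cons)
  moreover have "(last (v # q), hd (v # q)) \<in> E" using q_ne q_last xy symE by simp
  ultimately obtain i j where ij: "i + 1 < j" "j < length (v # q)"
    "(i, j + 1) \<noteq> (0, length (v # q))" "((v # q) ! i, (v # q) ! j) \<in> E"
    by (rule hole_freeD[OF hf])
  then obtain j' where j: "j = Suc j'" by (cases j) auto
  show False
  proof (cases i)
    \<comment> \<open>A chord at \<open>v\<close> ends at an inner vertex of the path: position 1 is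
      its neighbour on the cycle, and the last position belongs to the excluded closing
      edge.\<close>
    case 0
    have *: "0 < j'" "j' < length q - 1" "(v, q ! j') \<in> E" using ij by (auto simp: j 0)
    have "q ! j' \<noteq> q ! 0" "q ! j' \<noteq> q ! (length q - 1)"
      using * q_ne nth_eq_iff_index_eq[OF dist, of j' 0]
        nth_eq_iff_index_eq[OF dist, of j' "length q - 1"] by auto
    then have "q ! j' \<noteq> x" "q ! j' \<noteq> y" using q_hd q_last q_ne by (auto simp: hd_conv_nth last_conv_nth)
    then have "q ! j' \<in> C" using q_set * by (metis insertE nth_mem subsetD diff_le_self order_less_le_trans)
    then show False using C(3) * by blast
  next
    case (Suc i')
    then show False using nochord[of i' j'] ij j by auto
  qed
qed

text \<open>For a component \<open>C\<close> of the non-neighbours of \<open>v\<close>, the neighbours \<open>N\<close> of \<open>v\<close> that see \<open>C\<close> form a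
  clique. Induction on \<open>C \<union> N\<close>, started at a vertex whose non-neighbours lie in \<open>C\<close>, yields a
  simplicial vertex in \<open>C\<close>.\<close>

lemma dirac_simplicial:
  assumes "finite V" "hole_free V E" "sym E" "\<And>a. (a, a) \<notin> E"
    and "v \<in> V" "c \<in> V" "c \<noteq> v" "(v, c) \<notin> E"
  shows "\<exists>s\<in>V. s \<noteq> v \<and> (v, s) \<notin> E \<and> clique E {y \<in> V. (s, y) \<in> E}"
  using assms
proof (induction "card V" arbitrary: V v c rule: less_induct)
  case less
  have symE: "(b, a) \<in> E" if "(a, b) \<in> E" for a b using \<open>sym E\<close> that by (rule symD)
  define U where "U = {w \<in> V. w \<noteq> v \<and> (v, w) \<notin> E}"
  define C where "C = {w. (c, w) \<in> (E \<inter> U \<times> U)\<^sup>*}"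
  define N where "N = {y \<in> V. (v, y) \<in> E \<and> (\<exists>c\<in>C. (y, c) \<in> E)}"
  have "c \<in> U" using less.prems by (simp add: U_def)
  have "c \<in> C" by (simp add: C_def)
  have CU: "C \<subseteq> U"
  proof
    fix w assume "w \<in> C"
    then have "(c, w) \<in> (E \<inter> U \<times> U)\<^sup>*" by (simp add: C_def)
    then show "w \<in> U" using \<open>c \<in> U\<close> by (induction rule: rtrancl_induct) auto
  qed
  have step: "b \<in> C" if "a \<in> C" "(a, b) \<in> E" "b \<in> U" for a b
    using that CU unfolding C_def by (auto intro: rtrancl_into_rtrancl)
  have reach: "(c, w) \<in> (E \<inter> C \<times> C)\<^sup>*" if "w \<in> C" for w
  proof -
    have "(c, w) \<in> (E \<inter> U \<times> U)\<^sup>*" using that by (simp add: C_def)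
    then show ?thesis
    proof (induction rule: rtrancl_induct)
      case (step y z)
      then have "y \<in> C" "z \<in> C" by (auto simp: C_def intro: rtrancl_into_rtrancl)
      then show ?case using step by (auto intro: rtrancl_into_rtrancl)
    qed simp
  qed
  have "sym (E \<inter> C \<times> C)" using symE by (auto simp: sym_def)
  then have "sym ((E \<inter> C \<times> C)\<^sup>*)" by (rule sym_rtrancl)
  then have conn: "(a, b) \<in> (E \<inter> C \<times> C)\<^sup>*" if "a \<in> C" "b \<in> C" for a b
    using reach that by (meson rtrancl_trans symD)
  have N: "clique E N"
    unfolding N_def
  proof (rule hole_free_separator_clique[OF less.prems(2,3,4)])
    show "C \<subseteq> V" "v \<notin> C" "\<And>c. c \<in> C \<Longrightarrow> (v, c) \<notin> E" using CU by (auto simp: U_def)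
  qed (use conn less.prems in auto)
  let ?W = "C \<union> N"
  have W: "?W \<subseteq> V" "v \<notin> ?W" using CU less.prems(4) by (auto simp: U_def N_def)
  have "?W \<subset> V" using W less.prems(5) by blast
  then have smaller: "card ?W < card V" using less.prems(1) by (rule psubset_card_mono[rotated])
  have finW: "finite ?W" using W(1) less.prems(1) by (rule finite_subset)
  note hfW = hole_free_subset[OF less.prems(2) W(1)]
  \<comment> \<open>A vertex of \<open>C\<close> has no neighbours outside \<open>?W\<close>, so
    simplicial in \<open>?W\<close> means simplicial in \<open>V\<close>.\<close>
  have nbrs: "{y \<in> V. (s, y) \<in> E} \<subseteq> {y \<in> ?W. (s, y) \<in> E}" if "s \<in> C" for s
  proof
    fix y assume "y \<in> {y \<in> V. (s, y) \<in> E}"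
    then have y: "y \<in> V" "(s, y) \<in> E" by auto
    then have "y \<noteq> v" using that CU symE by (auto simp: U_def)
    then have "y \<in> N \<or> y \<in> C"
      using y step[OF that y(2)] symE[OF y(2)] that by (auto simp: U_def N_def)
    then show "y \<in> {y \<in> ?W. (s, y) \<in> E}" using y by blast
  qed
  have "\<exists>s\<in>C. clique E {y \<in> ?W. (s, y) \<in> E}"
  proof (cases "\<exists>w\<in>N. \<exists>z\<in>C. z \<noteq> w \<and> (w, z) \<notin> E")
    \<comment> \<open>The vertex found is not adjacent to \<open>w\<close>, hence lies outside the
      clique \<open>N\<close>.\<close>
    case True
    then obtain w z where wz: "w \<in> N" "z \<in> C" "z \<noteq> w" "(w, z) \<notin> E" by blast
    then obtain s where "s \<in> ?W" "s \<noteq> w" "(w, s) \<notin> E" "clique E {y \<in> ?W. (s, y) \<in> E}"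
      using less.hyps[OF smaller finW hfW less.prems(3,4), of w z] by blast
    moreover from this have "s \<notin> N" using N wz(1) symE unfolding clique_def by blast
    ultimately show ?thesis by blast
  next
    case NC: False
    show ?thesis
    proof (cases "\<exists>w\<in>C. \<exists>z\<in>C. z \<noteq> w \<and> (w, z) \<notin> E")
      \<comment> \<open>Every vertex of \<open>N\<close> is now adjacent to all of \<open>C\<close>,
        so a vertex not adjacent to \<open>w\<close> lies in \<open>C\<close>.\<close>
      case True
      then obtain w z where wz: "w \<in> C" "z \<in> C" "z \<noteq> w" "(w, z) \<notin> E" by blast
      then obtain s where s: "s \<in> ?W" "s \<noteq> w" "(w, s) \<notin> E" "clique E {y \<in> ?W. (s, y) \<in> E}"
        using less.hyps[OF smaller finW hfW less.prems(3,4), of w z] by blast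
      then have "s \<notin> N" using NC wz(1) symE[of s w] by metis
      then have "s \<in> C" using s(1) by blast
      then show ?thesis using s(4) by (intro bexI)
    next
      \<comment> \<open>Now \<open>?W\<close> is a clique, and \<open>c\<close> itself is simplicial
        in it.\<close>
      case False
      have "(a, b) \<in> E \<or> (b, a) \<in> E" if "a \<in> ?W" "b \<in> ?W" "a \<noteq> b" for a b
      proof (cases "a \<in> C")
        case True
        then show ?thesis using that False NC by (metis UnE)
      next
        case a: False
        show ?thesis
        proof (cases "b \<in> C")
          case True
          then show ?thesis using that a NC by (metis UnE)
        next
          case b: False
          then show ?thesis using that a N unfolding clique_def by blast
        qed
      qed
      then have "clique E ?W" by (simp add: clique_def)
      then have "clique E {y \<in> ?W. (c, y) \<in> E}" by (rule clique_subset) auto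
      then show ?thesis using \<open>c \<in> C\<close> by blast
    qed
  qed
  then obtain s where s: "s \<in> C" "clique E {y \<in> ?W. (s, y) \<in> E}" by blast
  have "clique E {y \<in> V. (s, y) \<in> E}" using clique_subset[OF s(2) nbrs[OF s(1)]] .
  then show ?case using s(1) CU by (auto simp: U_def)
qed

text \<open>The simplicial vertex is removed first and inserted last; the directions of its arcs
  split its neighbours into \<open>A\<close> and \<open>B\<close>.\<close>

lemma hole_free_peo:
  assumes "finite V" "R \<subseteq> V \<times> V" "hole_free V (R \<union> R\<inverse>)" "R \<inter> R\<inverse> = {}"
  shows "peo V R"
  using assms
proof (induction "card V" arbitrary: V R)
  case 0
  then have "V = {}" "R = {}" by auto
  then show ?case by (simp add: peo.empty)
next
  case (Suc n)
  let ?E = "R \<union> R\<inverse>"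
  have E: "sym ?E" "\<And>a. (a, a) \<notin> ?E" using Suc.prems(4) by (auto simp: sym_def)
  have "\<exists>s\<in>V. clique ?E {y \<in> V. (s, y) \<in> ?E}"
  proof (cases "clique ?E V")
    case True
    obtain s where "s \<in> V" using Suc.hyps(2) by fastforce
    moreover have "clique ?E {y \<in> V. (s, y) \<in> ?E}" using True by (rule clique_subset) auto
    ultimately show ?thesis by blast
  next
    case False
    then obtain v c where "v \<in> V" "c \<in> V" "c \<noteq> v" "(v, c) \<notin> ?E" unfolding clique_def by blast
    then show ?thesis using dirac_simplicial[OF Suc.prems(1,3) E] by blast
  qed
  then obtain s where s: "s \<in> V" "clique ?E {y \<in> V. (s, y) \<in> ?E}" by blast
  define A B where "A = {a. (s, a) \<in> R}" and "B = {b. (b, s) \<in> R}"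
  let ?W = "V - {s}"
  let ?R = "R \<inter> ?W \<times> ?W"
  have AB: "A \<subseteq> ?W" "B \<subseteq> ?W" "A \<inter> B = {}"
    using Suc.prems(2,4) E(2)[of s] by (auto simp: A_def B_def)
  have "peo ?W ?R"
  proof (rule Suc.hyps(1))
    have "?R \<union> ?R\<inverse> = ?E \<inter> ?W \<times> ?W" by auto
    then show "hole_free ?W (?R \<union> ?R\<inverse>)"
      using hole_free_restrict[OF hole_free_subset[OF Suc.prems(3), of ?W]] by auto
    show "n = card ?W" using Suc.hyps(2) s(1) Suc.prems(1) by simp
  qed (use Suc.prems in auto)
  moreover have "clique ?R (A \<union> B)"
    unfolding clique_def
  proof (intro ballI impI)
    fix u v assume uv: "u \<in> A \<union> B" "v \<in> A \<union> B" "u \<noteq> v"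
    then have "u \<in> {y \<in> V. (s, y) \<in> ?E}" "v \<in> {y \<in> V. (s, y) \<in> ?E}"
      using AB by (auto simp: A_def B_def)
    then have "(u, v) \<in> ?E" using s(2) uv(3) unfolding clique_def by blast
    then show "(u, v) \<in> ?R \<or> (v, u) \<in> ?R" using uv AB by auto
  qed
  ultimately have "peo (insert s ?W) (?R \<union> {s} \<times> A \<union> B \<times> {s})"
    using AB by (intro peo.insert) auto
  moreover have "insert s ?W = V" using s(1) by blast
  moreover have "?R \<union> {s} \<times> A \<union> B \<times> {s} = R"
    using Suc.prems(2) by (auto simp: A_def B_def)
  ultimately show ?case by simp
qed

lemma oriented_chordal_iff_peo: "oriented_chordal D \<longleftrightarrow> peo (pverts D) (parcs D)"
proof
  assume "oriented_chordal D"
  then obtain G where G: "chordal_graph G" "orientation_of D G"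
    unfolding oriented_chordal_def by blast
  interpret pair_graph G using G(1) by (simp add: chordal_graph_def)
  have D: "pverts D = pverts G" "parcs G = parcs D \<union> (parcs D)\<inverse>" "parcs D \<inter> (parcs D)\<inverse> = {}"
    using G(2) by (auto simp: orientation_of_def)
  show "peo (pverts D) (parcs D)"
  proof (rule hole_free_peo)
    show "parcs D \<subseteq> pverts D \<times> pverts D" using in_arcsD1 in_arcsD2 D by auto
    show "hole_free (pverts D) (parcs D \<union> (parcs D)\<inverse>)"
      using chordal_graph_hole_free[OF G(1)] D by simp
  qed (use D pair_finite_verts in auto)
qed (rule peo_oriented_chordal)

section \<open>Families of unbounded dichromatic number\<close>

definition monochromatic :: "('a \<Rightarrow> nat) \<Rightarrow> 'a rel \<Rightarrow> bool" where
  "monochromatic \<phi> R \<longleftrightarrow> (\<exists>a b c. three_cycle R a b c \<and> \<phi> a = \<phi> b \<and> \<phi> b = \<phi> c)"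

text \<open>It counts the colours actually used and asks for a triangle instead of a general cycle,
  so that it can be applied to a copy inside a larger digraph, as the recursive constructions
  require.\<close>

definition uncolourable :: "nat \<Rightarrow> 'a set \<Rightarrow> 'a rel \<Rightarrow> bool" where
  "uncolourable k V R \<longleftrightarrow> (\<forall>\<phi>. card (\<phi> ` V) \<le> k \<longrightarrow> monochromatic \<phi> R)"

lemma monochromatic_image:
  assumes "monochromatic (\<phi> \<circ> f) Q" "map_prod f f ` Q \<subseteq> R"
  shows "monochromatic \<phi> R"
proof -
  obtain a b c where "three_cycle Q a b c" "\<phi> (f a) = \<phi> (f b)" "\<phi> (f b) = \<phi> (f c)"
    using assms(1) by (auto simp: monochromatic_def)
  moreover from this have "three_cycle R (f a) (f b) (f c)"
    using assms(2) by (auto simp: three_cycle_def)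
  ultimately show ?thesis unfolding monochromatic_def by blast
qed

lemma monochromatic_mono: "monochromatic \<phi> R \<Longrightarrow> R \<subseteq> Q \<Longrightarrow> monochromatic \<phi> Q"
  unfolding monochromatic_def three_cycle_def by blast

text \<open>A copy that avoids the colour of \<open>x\<close> is coloured with at most
  \<open>k\<close> of the \<open>Suc k\<close> colours and so contains a monochromatic
  triangle.\<close>

lemma uncolourable_copy_meets_colour:
  assumes "uncolourable k W Q" "f ` W \<subseteq> V" "map_prod f f ` Q \<subseteq> R" "x \<in> V" "finite V"
    and "card (\<phi> ` V) \<le> Suc k" "\<not> monochromatic \<phi> R"
  shows "\<exists>w\<in>W. \<phi> (f w) = \<phi> x"
proof (rule ccontr)
  assume "\<not> ?thesis"
  then have "(\<phi> \<circ> f) ` W \<subseteq> \<phi> ` V - {\<phi> x}" using assms(2) by fastforce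
  then have "card ((\<phi> \<circ> f) ` W) \<le> card (\<phi> ` V - {\<phi> x})" using assms(5) by (intro card_mono) auto
  also have "\<dots> \<le> k" using assms(4-6) by simp
  finally have "monochromatic (\<phi> \<circ> f) Q" using assms(1) by (simp add: uncolourable_def)
  then show False using monochromatic_image assms(3,7) by blast
qed

section \<open>Tournaments of unbounded dichromatic number\<close>

lemma clique_peo:
  assumes "finite V" "R \<subseteq> V \<times> V" "R \<inter> R\<inverse> = {}" "clique R V"
  shows "peo V R"
proof (rule hole_free_peo[OF assms(1,2) _ assms(3)])
  show "hole_free V (R \<union> R\<inverse>)"
    unfolding hole_free_def
  proof (intro allI impI, elim conjE)
    fix xs assume xs: "set xs \<subseteq> V" "distinct xs" "4 \<le> length xs"
    \<comment> \<open>Positions 0 and 2 always carry a chord of a cycle of length at least 4: the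
      closing edge joins position 0 to a position of at least 3.\<close>
    then have "0 < length xs" "2 < length xs" by auto
    then have "xs ! 0 \<in> V" "xs ! 2 \<in> V" "xs ! 0 \<noteq> xs ! 2"
      using xs(1,2) nth_eq_iff_index_eq[OF xs(2), of 0 2] by (meson nth_mem subsetD, meson nth_mem subsetD, simp)
    then have "(xs ! 0, xs ! 2) \<in> R \<union> R\<inverse>" using assms(4) unfolding clique_def by blast
    then show "\<exists>i j. i + 1 < j \<and> j < length xs \<and> (i, j + 1) \<noteq> (0, length xs) \<and>
        (xs ! i, xs ! j) \<in> R \<union> R\<inverse>"
      using xs(3) by (intro exI[of _ 0] exI[of _ 2]) auto
  qed
qed

text \<open>The vertices and arcs of $\vec{C}_3(1,D,D)$, with \<open>0\<close> as the single vertex and the odd and the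
  positive even numbers as the two copies of \<open>D\<close>.\<close>

definition odd_copy :: "nat \<Rightarrow> nat" where
  "odd_copy n = 2 * n + 1"

definition even_copy :: "nat \<Rightarrow> nat" where
  "even_copy n = 2 * n + 2"

definition join_verts :: "nat set \<Rightarrow> nat set" where
  "join_verts V = insert 0 (odd_copy ` V \<union> even_copy ` V)"

definition join_arcs :: "nat set \<Rightarrow> nat rel \<Rightarrow> nat rel" where
  "join_arcs V R = map_prod odd_copy odd_copy ` R \<union> map_prod even_copy even_copy ` R \<union>
    odd_copy ` V \<times> even_copy ` V \<union> {0} \<times> odd_copy ` V \<union> even_copy ` V \<times> {0}"

lemma odd_even_copy_neq: "odd_copy a \<noteq> even_copy b"
proof -
  have "odd (odd_copy a)" "even (even_copy b)" by (simp_all add: odd_copy_def even_copy_def)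
  then show ?thesis by metis
qed

lemma copy_eq_iff:
  "odd_copy a \<noteq> 0" "even_copy a \<noteq> 0" "0 \<noteq> odd_copy a" "0 \<noteq> even_copy a"
  "odd_copy a \<noteq> even_copy b" "even_copy b \<noteq> odd_copy a"
  "odd_copy a = odd_copy b \<longleftrightarrow> a = b" "even_copy a = even_copy b \<longleftrightarrow> a = b"
  using odd_even_copy_neq[of a b] by (simp_all add: odd_copy_def even_copy_def)

lemma join_arcs_iff:
  "(odd_copy a, odd_copy b) \<in> join_arcs V R \<longleftrightarrow> (a, b) \<in> R"
  "(even_copy a, even_copy b) \<in> join_arcs V R \<longleftrightarrow> (a, b) \<in> R"
  "(odd_copy a, even_copy b) \<in> join_arcs V R \<longleftrightarrow> a \<in> V \<and> b \<in> V"
  "(even_copy a, odd_copy b) \<notin> join_arcs V R"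
  "(0, odd_copy a) \<in> join_arcs V R \<longleftrightarrow> a \<in> V" "(odd_copy a, 0) \<notin> join_arcs V R"
  "(even_copy a, 0) \<in> join_arcs V R \<longleftrightarrow> a \<in> V" "(0, even_copy a) \<notin> join_arcs V R"
  "(0, 0) \<notin> join_arcs V R"
  by (force simp: join_arcs_def image_iff Bex_def copy_eq_iff)+

lemma join_verts_cases:
  assumes "a \<in> join_verts V"
  shows "a = 0 \<or> (\<exists>u\<in>V. a = odd_copy u) \<or> (\<exists>u\<in>V. a = even_copy u)"
  using assms unfolding join_verts_def by blast

lemma join_arcs_subset:
  assumes "R \<subseteq> V \<times> V"
  shows "join_arcs V R \<subseteq> join_verts V \<times> join_verts V"
proof (rule subrelI)
  fix x y assume "(x, y) \<in> join_arcs V R"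
  with assms show "(x, y) \<in> join_verts V \<times> join_verts V"
    unfolding join_arcs_def join_verts_def by force
qed

lemma join_arcs_asym:
  assumes "R \<subseteq> V \<times> V" "R \<inter> R\<inverse> = {}"
  shows "join_arcs V R \<inter> (join_arcs V R)\<inverse> = {}"
proof -
  have R: "(b, a) \<notin> R" if "(a, b) \<in> R" for a b using assms(2) that by blast
  have "(b, a) \<notin> join_arcs V R" if ab: "(a, b) \<in> join_arcs V R" for a b
  proof -
    have "a \<in> join_verts V" "b \<in> join_verts V"
      using subsetD[OF join_arcs_subset[OF assms(1)] ab] by blast+
    from join_verts_cases[OF this(1)] join_verts_cases[OF this(2)] ab show ?thesis
      by (elim disjE bexE; simp add: join_arcs_iff; fast dest: R)
  qed
  then show ?thesis by blast
qed

lemma join_arcs_clique: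
  assumes "clique R V"
  shows "clique (join_arcs V R) (join_verts V)"
  unfolding clique_def
proof (intro ballI impI)
  fix a b assume ab: "a \<in> join_verts V" "b \<in> join_verts V" "a \<noteq> b"
  have R: "(u, v) \<in> R \<or> (v, u) \<in> R" if "u \<in> V" "v \<in> V" "u \<noteq> v" for u v
    using assms that unfolding clique_def by blast
  from join_verts_cases[OF ab(1)] join_verts_cases[OF ab(2)] ab(3)
  show "(a, b) \<in> join_arcs V R \<or> (b, a) \<in> join_arcs V R"
    by (elim disjE bexE; fastforce simp: join_arcs_iff dest: R)
qed

text \<open>Both copies repeat the colour of \<open>0\<close>, and \<open>0\<close>, any vertex of
  the odd copy and any vertex of the even copy form a triangle in this order.\<close>

lemma join_arcs_uncolourable:
  assumes "finite V" "uncolourable k V R"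
  shows "uncolourable (Suc k) (join_verts V) (join_arcs V R)"
  unfolding uncolourable_def
proof (intro allI impI, rule ccontr)
  fix \<phi> :: "nat \<Rightarrow> nat"
  assume \<phi>: "card (\<phi> ` join_verts V) \<le> Suc k" "\<not> monochromatic \<phi> (join_arcs V R)"
  have fin: "finite (join_verts V)" using assms(1) by (simp add: join_verts_def)
  have zero: "0 \<in> join_verts V" by (simp add: join_verts_def)
  have odd: "odd_copy ` V \<subseteq> join_verts V" "map_prod odd_copy odd_copy ` R \<subseteq> join_arcs V R"
    unfolding join_verts_def join_arcs_def by blast+
  have even: "even_copy ` V \<subseteq> join_verts V" "map_prod even_copy even_copy ` R \<subseteq> join_arcs V R"
    unfolding join_verts_def join_arcs_def by blast+
  obtain a where a: "a \<in> V" "\<phi> (odd_copy a) = \<phi> 0"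
    using uncolourable_copy_meets_colour[OF assms(2) odd zero fin \<phi>] by blast
  obtain b where b: "b \<in> V" "\<phi> (even_copy b) = \<phi> 0"
    using uncolourable_copy_meets_colour[OF assms(2) even zero fin \<phi>] by blast
  have "three_cycle (join_arcs V R) 0 (odd_copy a) (even_copy b)"
    using a(1) b(1) by (simp add: three_cycle_def join_arcs_iff)
  moreover have "\<phi> 0 = \<phi> (odd_copy a)" "\<phi> (odd_copy a) = \<phi> (even_copy b)" using a(2) b(2) by simp_all
  ultimately show False using \<phi>(2) unfolding monochromatic_def by blast
qed

lemma join_peo:
  assumes "peo V R" "clique R V"
  shows "peo (join_verts V) (join_arcs V R)"
proof (rule clique_peo)
  show "finite (join_verts V)" using peo_finite[OF assms(1)] by (simp add: join_verts_def)
  have "R \<inter> R\<inverse> = {}" using peo_asym[OF assms(1)] by blast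
  then show "join_arcs V R \<inter> (join_arcs V R)\<inverse> = {}"
    by (rule join_arcs_asym[OF peo_subset[OF assms(1)]])
qed (rule join_arcs_subset[OF peo_subset[OF assms(1)]], rule join_arcs_clique[OF assms(2)])

lemma uncolourable_tournament:
  "\<exists>(V :: nat set) R. peo V R \<and> clique R V \<and> uncolourable k V R"
proof (induction k)
  case 0
  \<comment> \<open>Zero colours cannot colour a nonempty vertex set.\<close>
  have "clique {} {0 :: nat}" "uncolourable 0 {0 :: nat} {}"
    by (simp_all add: clique_def uncolourable_def)
  moreover from this have "peo {0 :: nat} {}" by (intro clique_peo) simp_all
  ultimately show ?case by blast
next
  case (Suc k)
  then obtain V :: "nat set" and R where V: "peo V R" "clique R V" "uncolourable k V R" by blast
  show ?case
    using join_peo[OF V(1,2)] join_arcs_clique[OF V(2)]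
      join_arcs_uncolourable[OF peo_finite[OF V(1)] V(3)] by blast
qed

section \<open>Gluing copies onto the arcs of a transitive tournament\<close>

definition triangle_free :: "'a rel \<Rightarrow> 'a set \<Rightarrow> bool" where
  "triangle_free R Y \<longleftrightarrow> (\<forall>a\<in>Y. \<forall>b\<in>Y. \<forall>c\<in>Y. \<not> three_cycle R a b c)"

text \<open>The restriction that the family without dominated triangles and its reversals place on a
  hero; it is the hypothesis under which cliques are classified.\<close>

definition wheel_free :: "'a rel \<Rightarrow> 'a set \<Rightarrow> bool" where
  "wheel_free R S \<longleftrightarrow> (\<forall>Y\<subseteq>S. \<forall>x\<in>S.
    (\<forall>y\<in>Y. (x, y) \<in> R) \<or> (\<forall>y\<in>Y. (y, x) \<in> R) \<longrightarrow> triangle_free R Y)"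

text \<open>For a finite tournament on \<open>S\<close> this is C3(1,1,k) with k the size of
  \<open>Y\<close>, because a triangle-free tournament is transitive. A nonempty \<open>Y\<close>
  means that k is at least 1.\<close>

definition fan_shaped :: "'a rel \<Rightarrow> 'a set \<Rightarrow> bool" where
  "fan_shaped R S \<longleftrightarrow> (\<exists>u v Y. S = insert u (insert v Y) \<and> Y \<noteq> {} \<and> (u, v) \<in> R \<and>
    (\<forall>y\<in>Y. (v, y) \<in> R \<and> (y, u) \<in> R) \<and> triangle_free R Y)"

lemma fan_shapedI:
  assumes "S = insert u (insert v Y)" "Y \<noteq> {}" "(u, v) \<in> R"
    "\<And>y. y \<in> Y \<Longrightarrow> (v, y) \<in> R" "\<And>y. y \<in> Y \<Longrightarrow> (y, u) \<in> R" "triangle_free R Y"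
  shows "fan_shaped R S"
  unfolding fan_shaped_def
  by (intro exI[of _ u] exI[of _ v] exI[of _ Y] conjI ballI assms)

lemma triangle_free_insert:
  assumes "triangle_free R Y" "(v, v) \<notin> R" "(\<forall>y\<in>Y. (y, v) \<notin> R) \<or> (\<forall>y\<in>Y. (v, y) \<notin> R)"
  shows "triangle_free R (insert v Y)"
  using assms unfolding triangle_free_def three_cycle_def by blast

lemma three_cycle_cong:
  assumes "\<And>a b. a \<in> S \<Longrightarrow> b \<in> S \<Longrightarrow> (a, b) \<in> R \<longleftrightarrow> (a, b) \<in> R'" "a \<in> S" "b \<in> S" "c \<in> S"
  shows "three_cycle R a b c \<longleftrightarrow> three_cycle R' a b c"
  using assms by (simp add: three_cycle_def)

lemma triangle_free_cong:
  assumes "\<And>a b. a \<in> S \<Longrightarrow> b \<in> S \<Longrightarrow> (a, b) \<in> R \<longleftrightarrow> (a, b) \<in> R'" "Y \<subseteq> S"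
  shows "triangle_free R Y \<longleftrightarrow> triangle_free R' Y"
proof -
  have "three_cycle R a b c \<longleftrightarrow> three_cycle R' a b c" if "a \<in> Y" "b \<in> Y" "c \<in> Y" for a b c
    using that assms(2) by (intro three_cycle_cong[of S, OF assms(1)]) auto
  then show ?thesis unfolding triangle_free_def by simp
qed

lemma wheel_free_cong:
  assumes "\<And>a b. a \<in> S \<Longrightarrow> b \<in> S \<Longrightarrow> (a, b) \<in> R \<longleftrightarrow> (a, b) \<in> R'" "wheel_free R' S"
  shows "wheel_free R S"
  unfolding wheel_free_def
proof (intro allI ballI impI)
  fix Y x assume Y: "Y \<subseteq> S" "x \<in> S" "(\<forall>y\<in>Y. (x, y) \<in> R) \<or> (\<forall>y\<in>Y. (y, x) \<in> R)"
  have "(x, y) \<in> R' \<longleftrightarrow> (x, y) \<in> R" "(y, x) \<in> R' \<longleftrightarrow> (y, x) \<in> R" if "y \<in> Y" for y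
    using assms(1) Y(1,2) that by blast+
  then have "(\<forall>y\<in>Y. (x, y) \<in> R') \<or> (\<forall>y\<in>Y. (y, x) \<in> R')" using Y(3) by blast
  then have "triangle_free R' Y" using assms(2) Y(1,2) unfolding wheel_free_def by blast
  then show "triangle_free R Y" using triangle_free_cong[of S R R', OF assms(1) Y(1)] by blast
qed

lemma fan_shaped_cong:
  assumes "\<And>a b. a \<in> S \<Longrightarrow> b \<in> S \<Longrightarrow> (a, b) \<in> R \<longleftrightarrow> (a, b) \<in> R'" "fan_shaped R S"
  shows "fan_shaped R' S"
proof -
  obtain u v Y where Y: "S = insert u (insert v Y)" "Y \<noteq> {}" "(u, v) \<in> R"
    "\<forall>y\<in>Y. (v, y) \<in> R \<and> (y, u) \<in> R" "triangle_free R Y"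
    using assms(2) unfolding fan_shaped_def by blast
  have "triangle_free R' Y" using triangle_free_cong[of S R R' Y, OF assms(1)] Y by blast
  moreover have "(u, v) \<in> R'" "\<forall>y\<in>Y. (v, y) \<in> R' \<and> (y, u) \<in> R'"
    using assms(1) Y(1,3,4) by blast+
  ultimately show ?thesis using Y(1,2) unfolding fan_shaped_def by blast
qed

definition fan_cliques :: "'a set \<Rightarrow> 'a rel \<Rightarrow> bool" where
  "fan_cliques V R \<longleftrightarrow> (\<forall>S\<subseteq>V. clique R S \<and> wheel_free R S \<longrightarrow> triangle_free R S \<or> fan_shaped R S)"

text \<open>The classification sees only the arcs inside \<open>S\<close>, so it moves from a part
  to the glued digraph when the two relations agree there.\<close>

lemma fan_cliquesD_cong:
  assumes "fan_cliques V R" "S \<subseteq> V" "clique R' S" "wheel_free R' S"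
    and "\<And>a b. a \<in> S \<Longrightarrow> b \<in> S \<Longrightarrow> (a, b) \<in> R \<longleftrightarrow> (a, b) \<in> R'"
  shows "triangle_free R' S \<or> fan_shaped R' S"
proof -
  have "clique R S" using assms(3,5) by (simp add: clique_def)
  moreover have "wheel_free R S" using wheel_free_cong[of S R R', OF assms(5,4)] .
  ultimately have "triangle_free R S \<or> fan_shaped R S"
    using assms(1,2) by (simp add: fan_cliques_def)
  then show ?thesis
    using triangle_free_cong[of S R R' S, OF assms(5)] fan_shaped_cong[of S R R', OF assms(5)] by blast
qed

lemma clique_insert:
  assumes "clique R K" "\<forall>w\<in>K. (v, w) \<in> R \<or> (w, v) \<in> R"
  shows "clique R (insert v K)"
  using assms by (auto simp: clique_def)

text \<open>The elimination order of \<open>W\<close> is run after that of \<open>V\<close>. Each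
  vertex of \<open>W\<close> gains the earlier neighbours \<open>u\<close> and \<open>v\<close>,
  which are joined to each other and to all of \<open>W\<close>, so its earlier neighbours stay a
  clique.\<close>

lemma peo_glue:
  assumes "peo W Q" "peo V R" "V \<inter> W = {}" "(u, v) \<in> R"
  shows "peo (V \<union> W) (R \<union> Q \<union> {v} \<times> W \<union> W \<times> {u})"
  using assms(1,3)
proof (induction rule: peo.induct)
  case empty
  then show ?case using assms(2) by simp
next
  case (insert W Q x A B)
  let ?R = "R \<union> Q \<union> {v} \<times> W \<union> W \<times> {u}"
  have uv: "u \<in> V" "v \<in> V" "u \<noteq> v"
    using subsetD[OF peo_subset[OF assms(2)] assms(4)] peo_irrefl[OF assms(2), of u] assms(4) by auto
  have "peo (insert x (V \<union> W)) (?R \<union> {x} \<times> insert u A \<union> insert v B \<times> {x})"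
  proof (rule peo.insert)
    show "peo (V \<union> W) ?R" using insert by auto
    show "insert u A \<inter> insert v B = {}" using insert.prems insert.hyps uv by blast
    have old: "clique ?R (A \<union> B)" using insert.hyps(6) by (rule clique_mono) auto
    have new: "(v, w) \<in> ?R" "(w, u) \<in> ?R" if "w \<in> A \<union> B" for w
      using that insert.hyps(3,4) by auto
    have "(u, v) \<in> ?R" using assms(4) by simp
    then have "clique ?R (insert u (insert v (A \<union> B)))"
      by (intro clique_insert old ballI) (use new in \<open>blast, elim insertE, simp, blast\<close>)
    then show "clique ?R (insert u A \<union> insert v B)" by (simp add: insert_commute)
  qed (use insert uv in auto)
  moreover have "?R \<union> {x} \<times> insert u A \<union> insert v B \<times> {x} =
    R \<union> (Q \<union> {x} \<times> A \<union> B \<times> {x}) \<union> {v} \<times> insert x W \<union> insert x W \<times> {u}" by blast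
  ultimately show ?case by simp
qed

lemma clique_image:
  assumes "clique R K"
  shows "clique (map_prod f f ` R) (f ` K)"
  unfolding clique_def
proof (intro ballI impI)
  fix u v assume "u \<in> f ` K" "v \<in> f ` K" "u \<noteq> v"
  then obtain a b where ab: "a \<in> K" "b \<in> K" "a \<noteq> b" "u = f a" "v = f b" by blast
  then have "(a, b) \<in> R \<or> (b, a) \<in> R" using assms by (simp add: clique_def)
  then show "(u, v) \<in> map_prod f f ` R \<or> (v, u) \<in> map_prod f f ` R"
    unfolding ab(4,5) by (metis image_eqI map_prod_simp)
qed

lemma peo_image:
  assumes "peo W Q" "inj f"
  shows "peo (f ` W) (map_prod f f ` Q)"
  using assms(1)
proof (induction rule: peo.induct)
  case empty
  then show ?case by (simp add: peo.empty)
next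
  case (insert V R x A B)
  have "peo (insert (f x) (f ` V)) (map_prod f f ` R \<union> {f x} \<times> f ` A \<union> f ` B \<times> {f x})"
  proof (rule peo.insert)
    show "f x \<notin> f ` V" using insert.hyps(2) assms(2) by (auto dest: injD)
    show "f ` A \<inter> f ` B = {}" using insert.hyps(5) assms(2) by (auto dest: injD)
    show "clique (map_prod f f ` R) (f ` A \<union> f ` B)"
      using clique_image[OF insert.hyps(6), of f] by (simp add: image_Un)
  qed (use insert in auto)
  moreover have "map_prod f f ` R \<union> {f x} \<times> f ` A \<union> f ` B \<times> {f x} =
    map_prod f f ` (R \<union> {x} \<times> A \<union> B \<times> {x})" by (auto simp: image_Un)
  ultimately show ?case by simp
qed

lemma fan_cliques_image:
  assumes "fan_cliques W Q" "inj f"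
  shows "fan_cliques (f ` W) (map_prod f f ` Q)"
  unfolding fan_cliques_def
proof (intro allI impI, elim conjE)
  fix S assume S: "S \<subseteq> f ` W" "clique (map_prod f f ` Q) S" "wheel_free (map_prod f f ` Q) S"
  then obtain T where T: "T \<subseteq> W" "S = f ` T" by (meson subset_imageE)
  let ?Q = "map_prod f f ` Q"
  have iff: "(f a, f b) \<in> ?Q \<longleftrightarrow> (a, b) \<in> Q" for a b using assms(2) by (auto dest: injD)
  have eq: "f a = f b \<longleftrightarrow> a = b" for a b using assms(2) by (auto dest: injD)
  have tc: "three_cycle ?Q (f a) (f b) (f c) \<longleftrightarrow> three_cycle Q a b c" for a b c
    by (simp only: three_cycle_def iff)
  have tf: "triangle_free ?Q (f ` Y) \<longleftrightarrow> triangle_free Q Y" for Y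
    unfolding triangle_free_def by (simp only: ball_simps(9) tc)
  have "clique Q T" using S(2) unfolding T(2) clique_def by (simp only: ball_simps(9) iff eq) 
  moreover have "wheel_free Q T"
    unfolding wheel_free_def
  proof (intro allI ballI impI)
    fix Y x assume Y: "Y \<subseteq> T" "x \<in> T" "(\<forall>y\<in>Y. (x, y) \<in> Q) \<or> (\<forall>y\<in>Y. (y, x) \<in> Q)"
    then have "f ` Y \<subseteq> S" "f x \<in> S"
      "(\<forall>y\<in>f ` Y. (f x, y) \<in> ?Q) \<or> (\<forall>y\<in>f ` Y. (y, f x) \<in> ?Q)" unfolding T(2) by auto
    then have "triangle_free ?Q (f ` Y)" using S(3) unfolding wheel_free_def by blast
    then show "triangle_free Q Y" by (simp only: tf)
  qed
  ultimately have "triangle_free Q T \<or> fan_shaped Q T" using assms(1) T(1) by (simp add: fan_cliques_def)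
  then show "triangle_free ?Q S \<or> fan_shaped ?Q S"
  proof
    assume "fan_shaped Q T"
    then obtain u v Y where Y: "T = insert u (insert v Y)" "Y \<noteq> {}" "(u, v) \<in> Q"
      "\<forall>y\<in>Y. (v, y) \<in> Q \<and> (y, u) \<in> Q" "triangle_free Q Y"
      unfolding fan_shaped_def by blast
    have "fan_shaped ?Q S"
    proof (rule fan_shapedI)
      show "S = insert (f u) (insert (f v) (f ` Y))" using Y(1) T(2) by simp
      show "triangle_free ?Q (f ` Y)" using Y(5) tf by simp
    qed (use Y(2-4) in auto)
    then show ?thesis ..
  qed (simp add: T(2) tf)
qed

text \<open>Among the vertices of \<open>V\<close>, only \<open>u\<close> and \<open>v\<close> have
  neighbours in \<open>W\<close>. A clique that meets both \<open>W\<close> and \<open>V\<close> is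
  thus a part \<open>Y\<close> of \<open>W\<close> with one or both of them. As \<open>v\<close>
  dominates \<open>Y\<close> and \<open>u\<close> is dominated by it, wheel-freeness makes
  \<open>Y\<close> triangle-free. Both vertices give a fan; a single one adds no triangle.\<close>

lemma fan_cliques_glue:
  assumes W: "peo W Q" "fan_cliques W Q" and V: "peo V R" "fan_cliques V R"
    and disj: "V \<inter> W = {}" and uv: "(u, v) \<in> R"
  shows "fan_cliques (V \<union> W) (R \<union> Q \<union> {v} \<times> W \<union> W \<times> {u})"
  unfolding fan_cliques_def
proof (intro allI impI, elim conjE)
  let ?R = "R \<union> Q \<union> {v} \<times> W \<union> W \<times> {u}"
  fix S assume S: "S \<subseteq> V \<union> W" "clique ?R S" "wheel_free ?R S"
  have sub: "R \<subseteq> V \<times> V" "Q \<subseteq> W \<times> W" using peo_subset V(1) W(1) by blast+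
  have uv': "u \<in> V" "v \<in> V" "u \<noteq> v" "(v, u) \<notin> R"
    using sub uv peo_irrefl[OF V(1)] peo_asym[OF V(1)] by blast+
  define Y where "Y = S \<inter> W"
  show "triangle_free ?R S \<or> fan_shaped ?R S"
  proof (cases "Y = {}")
    case True
    then have SV: "S \<subseteq> V" using S(1) by (auto simp: Y_def)
    show ?thesis
    proof (rule fan_cliquesD_cong[OF V(2) SV S(2,3)])
      show "(a, b) \<in> R \<longleftrightarrow> (a, b) \<in> ?R" if "a \<in> S" "b \<in> S" for a b
        using that SV disj sub(2) by blast
    qed
  next
    case False
    then obtain w where w: "w \<in> S" "w \<in> W" by (auto simp: Y_def)
    have SY: "S \<subseteq> insert u (insert v Y)"
    proof
      fix s assume s: "s \<in> S"
      show "s \<in> insert u (insert v Y)"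
      proof (cases "s \<in> W")
        case False
        then have "(s, w) \<in> ?R \<or> (w, s) \<in> ?R" using S(2) s w unfolding clique_def by metis
        then show ?thesis using False w sub disj by blast
      qed (use s in \<open>simp add: Y_def\<close>)
    qed
    show ?thesis
    proof (cases "u \<in> S \<or> v \<in> S")
      case False
      then have SW: "S \<subseteq> W" using SY by (auto simp: Y_def)
      show ?thesis
      proof (rule fan_cliquesD_cong[OF W(2) SW S(2,3)])
        show "(a, b) \<in> Q \<longleftrightarrow> (a, b) \<in> ?R" if "a \<in> S" "b \<in> S" for a b
          using that SW disj sub(1) uv' by blast
      qed
    next
      case True
      have arcs: "(v, y) \<in> ?R" "(y, u) \<in> ?R" if "y \<in> Y" for y using that by (auto simp: Y_def)
      have noarcs: "(y, v) \<notin> ?R" "(u, y) \<notin> ?R" if "y \<in> Y" for y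
        using that sub disj uv' by (auto simp: Y_def)
      have irr: "(v, v) \<notin> ?R" "(u, u) \<notin> ?R"
        using uv' sub disj peo_irrefl[OF V(1)] by blast+
      have "Y \<subseteq> S" by (simp add: Y_def)
      then have Y: "triangle_free ?R Y"
        using True S(3) arcs unfolding wheel_free_def by blast
      show ?thesis
      proof (cases "u \<in> S \<and> v \<in> S")
        case True
        then have "S = insert u (insert v Y)" using SY by (auto simp: Y_def)
        then have "fan_shaped ?R S" by (rule fan_shapedI) (use Y arcs uv \<open>Y \<noteq> {}\<close> in simp_all)
        then show ?thesis ..
      next
        case False
        then consider "S = insert u Y" | "S = insert v Y"
          using True SY \<open>Y \<subseteq> S\<close> by blast
        then show ?thesis
          using triangle_free_insert[OF Y] irr noarcs by cases blast+
      qed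
    qed
  qed
qed

lemma uncolourable_fan_cliques:
  "\<exists>(V :: nat set) R. peo V R \<and> fan_cliques V R \<and> uncolourable k V R"
proof (induction k)
  case 0
  have "peo {0 :: nat} {}" by (rule clique_peo) (auto simp: clique_def)
  moreover have "fan_cliques {0 :: nat} {}"
    by (auto simp: fan_cliques_def triangle_free_def three_cycle_def)
  ultimately show ?case by (intro exI[of _ "{0}"] exI[of _ "{}"]) (auto simp: uncolourable_def)
next
  case (Suc k)
  then obtain W :: "nat set" and Q where W: "peo W Q" "fan_cliques W Q" "uncolourable k W Q" by blast
  \<comment> \<open>One vertex more than the \<open>Suc k\<close> colours, so two vertices of this
    transitive tournament agree in colour.\<close>
  define V0 :: "nat set" where "V0 = {..<k + 2}"
  define R0 where "R0 = {(i, j). i < j \<and> j < k + 2}"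
  have "R0 \<subseteq> V0 \<times> V0" by (auto simp: R0_def V0_def)
  then have "finite R0" by (rule finite_subset) (simp add: V0_def)
  \<comment> \<open>Having a copy survives enlarging the digraph, so copies can be attached one arc
    at a time.\<close>
  define has_copy where "has_copy V R e \<longleftrightarrow> (\<exists>f. f ` W \<subseteq> V \<and> map_prod f f ` Q \<subseteq> R \<and>
    {snd e} \<times> f ` W \<subseteq> R \<and> f ` W \<times> {fst e} \<subseteq> R)" for V R and e :: "nat \<times> nat"
  have has_copy_mono: "has_copy V' R' e" if "has_copy V R e" "V \<subseteq> V'" "R \<subseteq> R'" for V R V' R' e
    using that unfolding has_copy_def by (meson order_trans)
  have "\<exists>V R. peo V R \<and> fan_cliques V R \<and> V0 \<subseteq> V \<and> R0 \<subseteq> R \<and> (\<forall>e\<in>F. has_copy V R e)"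
    if "F \<subseteq> R0" for F
    using finite_subset[OF that \<open>finite R0\<close>] that
  proof (induction rule: finite_induct)
    case empty
    have "peo V0 R0"
      by (rule clique_peo) (auto simp: V0_def R0_def clique_def)
    moreover have "fan_cliques V0 R0"
      by (auto simp: fan_cliques_def triangle_free_def three_cycle_def R0_def)
    ultimately show ?case by blast
  next
    case (insert e F)
    obtain u v where e: "e = (u, v)" by (cases e)
    from insert obtain V R where V: "peo V R" "fan_cliques V R" "V0 \<subseteq> V" "R0 \<subseteq> R"
      "\<forall>e\<in>F. has_copy V R e" by auto
    have "\<exists>m. \<forall>x\<in>V. x < m" using peo_finite[OF V(1)] by (simp add: finite_nat_set_iff_bounded)
    then obtain m where m: "\<And>x. x \<in> V \<Longrightarrow> x < m" by blast
    \<comment> \<open>Shifting by a bound for \<open>V\<close> makes the copy disjoint from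
      everything built so far.\<close>
    define g where "g n = n + m" for n
    have "inj g" by (auto simp: g_def inj_on_def)
    moreover have "g w \<notin> V" for w using m[of "g w"] by (auto simp: g_def)
    ultimately have g: "inj g" "V \<inter> g ` W = {}" by auto
    have uv: "(u, v) \<in> R" using insert.prems V(4) e by auto
    let ?V = "V \<union> g ` W" and ?R = "R \<union> map_prod g g ` Q \<union> {v} \<times> g ` W \<union> g ` W \<times> {u}"
    have "peo ?V ?R" by (rule peo_glue[OF peo_image[OF W(1) g(1)] V(1) g(2) uv])
    moreover have "fan_cliques ?V ?R"
      by (rule fan_cliques_glue[OF peo_image[OF W(1) g(1)] fan_cliques_image[OF W(2) g(1)]
            V(1,2) g(2) uv])
    moreover have "has_copy ?V ?R e" unfolding has_copy_def e fst_conv snd_conv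
      by (intro exI[of _ g] conjI Un_upper2 Un_upper1 le_supI1)
    moreover have "has_copy ?V ?R e'" if "e' \<in> F" for e'
      by (rule has_copy_mono[OF bspec[OF V(5) that]]) (intro Un_upper1 le_supI1 order_refl)+
    moreover have "V0 \<subseteq> ?V" "R0 \<subseteq> ?R" using V(3,4) by (simp_all add: le_supI1)
    ultimately show ?case by (intro exI[of _ ?V] exI[of _ ?R] conjI ballI) (auto elim!: insertE)
  qed
  from this[OF order_refl] obtain V R where
    V: "peo V R" "fan_cliques V R" "V0 \<subseteq> V" "R0 \<subseteq> R" and copy: "\<And>e. e \<in> R0 \<Longrightarrow> has_copy V R e"
    by blast
  have "uncolourable (Suc k) V R"
    unfolding uncolourable_def
  proof (intro allI impI, rule ccontr)
    fix \<phi> :: "nat \<Rightarrow> nat" assume \<phi>: "card (\<phi> ` V) \<le> Suc k" "\<not> monochromatic \<phi> R"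
    have "card (\<phi> ` V0) \<le> card (\<phi> ` V)" using V(3) peo_finite[OF V(1)] by (intro card_mono) auto
    then have "card (\<phi> ` V0) < card V0" using \<phi>(1) by (simp add: V0_def)
    then have "\<not> inj_on \<phi> V0" by (rule pigeonhole)
    then obtain i j where ij: "i \<in> V0" "j \<in> V0" "i < j" "\<phi> i = \<phi> j"
      unfolding inj_on_def by (metis linorder_neqE_nat)
    then have "(i, j) \<in> R0" by (auto simp: R0_def V0_def)
    then obtain f where f: "f ` W \<subseteq> V" "map_prod f f ` Q \<subseteq> R" "{j} \<times> f ` W \<subseteq> R" "f ` W \<times> {i} \<subseteq> R"
      using copy[of "(i, j)"] unfolding has_copy_def fst_conv snd_conv by meson
    \<comment> \<open>The copy attached to the arc from \<open>i\<close> to \<open>j\<close> repeats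
      their common colour and closes a triangle with that arc.\<close>
    have "\<exists>w\<in>W. \<phi> (f w) = \<phi> i"
      by (rule uncolourable_copy_meets_colour[OF W(3) f(1,2) _ peo_finite[OF V(1)] \<phi>])
        (use ij V(3) in auto)
    then obtain w where w: "w \<in> W" "\<phi> (f w) = \<phi> i" by blast
    have "(i, j) \<in> R" using V(4) \<open>(i, j) \<in> R0\<close> by (rule subsetD)
    moreover have "(j, f w) \<in> R" using w(1) by (intro subsetD[OF f(3)]) simp
    moreover have "(f w, i) \<in> R" using w(1) by (intro subsetD[OF f(4)]) simp
    ultimately have "three_cycle R i j (f w)" by (simp add: three_cycle_def)
    then show False using \<phi>(2) w ij(4) unfolding monochromatic_def by metis
  qed
  then show ?case using V by blast
qed

section \<open>Splicing vertices into transitive lists\<close>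

definition no_out_triangle :: "'a rel \<Rightarrow> bool" where
  "no_out_triangle R \<longleftrightarrow>
    (\<forall>x a b c. (x, a) \<in> R \<longrightarrow> (x, b) \<in> R \<longrightarrow> (x, c) \<in> R \<longrightarrow> \<not> three_cycle R a b c)"

lemma trans_list_mono: "trans_list R xs \<Longrightarrow> R \<subseteq> Q \<Longrightarrow> trans_list Q xs"
  by (erule sorted_wrt_mono_rel[rotated]) auto

lemma trans_list_clique: "trans_list R xs \<Longrightarrow> clique R (set xs)"
  by (induction xs) (auto simp: clique_def)

text \<open>The first vertex of the list receives no arc from the list, so it lies on no triangle
  inside it.\<close>

lemma trans_list_no_three_cycle:
  assumes "trans_list R xs" "\<And>a b. (a, b) \<in> R \<Longrightarrow> (b, a) \<notin> R" "{a, b, c} \<subseteq> set xs"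
  shows "\<not> three_cycle R a b c"
  using assms(1,3)
proof (induction xs arbitrary: a b c)
  case (Cons x xs)
  have no: "(y, x) \<notin> R" if "y \<in> set (x # xs)" for y
    using that Cons.prems(1) assms(2)[of x y] assms(2)[of x x] by auto
  show ?case
  proof
    assume t: "three_cycle R a b c"
    then have "a \<noteq> x" "b \<noteq> x" "c \<noteq> x"
      using Cons.prems(2) no[of a] no[of b] no[of c] by (auto simp: three_cycle_def)
    then show False using Cons.IH[of a b c] Cons.prems t by auto
  qed
qed (auto simp: three_cycle_def)

text \<open>The out-neighbours of \<open>y\<close> come from a transitive list, so \<open>y\<close>
  dominates no triangle. A triangle through \<open>y\<close> is y -> q -> p -> y with p in
  \<open>P\<close>, and the arcs from \<open>P\<close> to \<open>Q\<close> force q into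
  \<open>A\<close>. A vertex dominating it has \<open>y\<close> as out-neighbour, hence lies in
  \<open>P\<close>, but then its arc with q starts at q.\<close>

lemma no_out_triangle_insert:
  assumes "peo V R" "no_out_triangle R" "y \<notin> V"
    and "trans_list R (A @ P @ Q)" "set (A @ P @ Q) \<subseteq> V"
  defines "R' \<equiv> R \<union> {y} \<times> (set A \<union> set Q) \<union> set P \<times> {y}"
  shows "peo (insert y V) R'" "no_out_triangle R'"
proof -
  note sub = peo_subset[OF assms(1)] and asym = peo_asym[OF assms(1)]
  have AP: "(a, p) \<in> R" if "a \<in> set A" "p \<in> set P" for a p
    using assms(4) that by (auto simp: sorted_wrt_append)
  have PQ: "(p, q) \<in> R" if "p \<in> set P" "q \<in> set Q" for p q
    using assms(4) that by (auto simp: sorted_wrt_append)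
  have "distinct (A @ P @ Q)"
    using assms(4) peo_irrefl[OF assms(1)] by (rule trans_list_distinct)
  then have disj: "(set A \<union> set Q) \<inter> set P = {}" by auto
  have V: "set A \<union> set Q \<subseteq> V" "set P \<subseteq> V" using assms(5) by auto
  have cl: "clique R (set A \<union> set Q \<union> set P)"
    using trans_list_clique[OF assms(4)] by (rule clique_subset) auto
  show "peo (insert y V) R'"
    unfolding R'_def by (rule peo.insert[OF assms(1,3) V disj cl])
  have yR: "(y, a) \<notin> R" "(a, y) \<notin> R" for a using sub assms(3) by auto
  have out: "a \<in> set A \<union> set Q" if "(y, a) \<in> R'" for a
    using that yR(1)[of a] V(2) assms(3) unfolding R'_def by auto
  have inn: "a \<in> set P" if "(a, y) \<in> R'" for a
    using that yR(2)[of a] V(1) assms(3) unfolding R'_def by auto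
  have old: "(a, b) \<in> R" if "(a, b) \<in> R'" "a \<noteq> y" "b \<noteq> y" for a b
    using that unfolding R'_def by auto
  show "no_out_triangle R'"
    unfolding no_out_triangle_def
  proof (intro allI impI notI)
    fix x a b c assume x: "(x, a) \<in> R'" "(x, b) \<in> R'" "(x, c) \<in> R'" and t: "three_cycle R' a b c"
    from three_cycle_insert[OF t[unfolded R'_def] sub assms(3) V disj] show False
    proof (elim disjE bexE conjE)
      assume t: "three_cycle R a b c"
      then have ne: "a \<noteq> y" "b \<noteq> y" "c \<noteq> y" using yR by (auto simp: three_cycle_def)
      show False
      proof (cases "x = y")
        case True
        then have "{a, b, c} \<subseteq> set (A @ P @ Q)" using out x by fastforce
        then show False using trans_list_no_three_cycle[OF assms(4) asym] t by blast
      next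
        case False
        then have "(x, a) \<in> R" "(x, b) \<in> R" "(x, c) \<in> R" using x ne old by auto
        then show False using assms(2) t unfolding no_out_triangle_def by blast
      qed
    next
      fix q p assume pq: "q \<in> set A \<union> set Q" "p \<in> set P" "(q, p) \<in> R" "{a, b, c} = {y, q, p}"
      have "\<forall>z\<in>{a, b, c}. (x, z) \<in> R'" using x by simp
      then have x': "(x, y) \<in> R'" "(x, q) \<in> R'" "(x, p) \<in> R'" unfolding pq(4) by simp_all
      have xP: "x \<in> set P" using inn x'(1) .
      have "x \<noteq> y" "q \<noteq> y" using xP pq(1) V assms(3) by auto
      then have xq: "(x, q) \<in> R" using old x'(2) by blast
      show False
        using pq(1)
      proof
        assume "q \<in> set A"
        then show False using AP xP xq asym by blast
      next
        assume "q \<in> set Q"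
        then show False using PQ pq(2,3) asym by blast
      qed
    qed
  qed
qed

text \<open>A colour that occurs in both \<open>A\<close> and \<open>P\<close> is forbidden at the spliced vertex \<open>y\<close>: an arc from
  \<open>A\<close> to \<open>P\<close> in that colour closes a directed triangle with \<open>y\<close>.\<close>

definition splice_extension :: "'a set \<Rightarrow> 'a rel \<Rightarrow> 'a set \<Rightarrow> 'a rel \<Rightarrow> bool" where
  "splice_extension V R V' R' \<longleftrightarrow> V \<subseteq> V' \<and> R \<subseteq> R' \<and>
    (\<forall>A P Q. trans_list R (A @ P @ Q) \<longrightarrow> set (A @ P @ Q) \<subseteq> V \<longrightarrow>
      (\<exists>y\<in>V'. {y} \<times> (set A \<union> set Q) \<union> set P \<times> {y} \<subseteq> R'))"

text \<open>One new vertex serves each way of cutting a transitive list of \<open>V\<close> into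
  three. Such lists have no repetitions, so they are finitely many. All cuts are provided because
  the digraph is fixed before the colouring, which decides the useful cut, is known.\<close>

lemma splice_extension_exists:
  fixes V :: "nat set"
  assumes "peo V R" "no_out_triangle R"
  shows "\<exists>V' R'. peo V' R' \<and> no_out_triangle R' \<and> splice_extension V R V' R'"
proof -
  define good where "good = {(A, P, Q). trans_list R (A @ P @ Q) \<and> set (A @ P @ Q) \<subseteq> V}"
  define L where "L = {xs. set xs \<subseteq> V \<and> length xs \<le> card V}"
  have fin: "finite V" by (rule peo_finite[OF assms(1)])
  have "good \<subseteq> L \<times> L \<times> L"
  proof
    fix x assume "x \<in> good"
    then obtain A P Q where x: "x = (A, P, Q)" "trans_list R (A @ P @ Q)" "set (A @ P @ Q) \<subseteq> V"
      by (auto simp: good_def)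
    have "distinct (A @ P @ Q)" using x(2) peo_irrefl[OF assms(1)] by (rule trans_list_distinct)
    then have "length (A @ P @ Q) = card (set (A @ P @ Q))" by (metis distinct_card)
    also have "\<dots> \<le> card V" using x(3) fin by (rule card_mono[rotated])
    finally show "x \<in> L \<times> L \<times> L" using x(1,3) by (simp add: L_def)
  qed
  moreover have "finite L" unfolding L_def using fin by (rule finite_lists_length_le)
  ultimately have "finite good" by (meson finite_SigmaI finite_subset)
  define ok where "ok V' R' e \<longleftrightarrow> (case e of (A, P, Q) \<Rightarrow>
      \<exists>y\<in>V'. {y} \<times> (set A \<union> set Q) \<union> set P \<times> {y} \<subseteq> R')"
    for V' R' and e :: "nat list \<times> nat list \<times> nat list"
  have ok_mono: "ok W Q e" if "ok V' R' e" "V' \<subseteq> W" "R' \<subseteq> Q" for V' R' W Q e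
    using that unfolding ok_def by (cases e) (simp only: prod.case, meson order_trans subsetD)
  have "\<exists>V' R'. peo V' R' \<and> no_out_triangle R' \<and> V \<subseteq> V' \<and> R \<subseteq> R' \<and> (\<forall>e\<in>F. ok V' R' e)"
    if "F \<subseteq> good" for F
    using finite_subset[OF that \<open>finite good\<close>] that
  proof (induction rule: finite_induct)
    case empty
    then show ?case using assms by blast
  next
    case (insert e F)
    then obtain V' R' where V': "peo V' R'" "no_out_triangle R'" "V \<subseteq> V'" "R \<subseteq> R'"
      and F: "\<forall>e\<in>F. ok V' R' e" by auto
    obtain A P Q where e: "e = (A, P, Q)" "trans_list R (A @ P @ Q)" "set (A @ P @ Q) \<subseteq> V"
      using insert.prems by (auto simp: good_def)
    obtain y where y: "y \<notin> V'" using peo_finite[OF V'(1)] ex_new_if_finite infinite_UNIV_nat by blast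
    define R'' where "R'' = R' \<union> {y} \<times> (set A \<union> set Q) \<union> set P \<times> {y}"
    note ext = no_out_triangle_insert[OF V'(1,2) y trans_list_mono[OF e(2) V'(4)]
        order_trans[OF e(3) V'(3)], folded R''_def]
    have sub: "V' \<subseteq> insert y V'" "R' \<subseteq> R''" by (auto simp: R''_def)
    have "ok (insert y V') R'' e"
      unfolding ok_def e(1) prod.case by (rule bexI[of _ y]) (auto simp: R''_def)
    then have "\<forall>e\<in>insert e F. ok (insert y V') R'' e" using F ok_mono[OF _ sub] by simp
    then show ?case
      using ext order_trans[OF V'(3) sub(1)] order_trans[OF V'(4) sub(2)] by blast
  qed
  from this[OF order_refl] obtain V' R' where V': "peo V' R'" "no_out_triangle R'" "V \<subseteq> V'" "R \<subseteq> R'"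
    and *: "\<forall>e\<in>good. ok V' R' e" by blast
  have "splice_extension V R V' R'"
    unfolding splice_extension_def
  proof (intro conjI allI impI V')
    fix A P Q assume "trans_list R (A @ P @ Q)" "set (A @ P @ Q) \<subseteq> V"
    then have "(A, P, Q) \<in> good" by (simp add: good_def)
    from bspec[OF * this] show "\<exists>y\<in>V'. {y} \<times> (set A \<union> set Q) \<union> set P \<times> {y} \<subseteq> R'"
      by (simp only: ok_def prod.case)
  qed
  then show ?thesis using V'(1,2) by blast
qed

lemma splice_colour:
  assumes "\<not> monochromatic \<phi> R'" "R \<subseteq> R'" "trans_list R (A @ P @ Q)"
    and "{y} \<times> (set A \<union> set Q) \<union> set P \<times> {y} \<subseteq> R'" "S \<subseteq> \<phi> ` set A" "S \<subseteq> \<phi> ` set P"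
  shows "\<phi> y \<notin> S"
proof
  assume "\<phi> y \<in> S"
  then have "\<phi> y \<in> \<phi> ` set A" "\<phi> y \<in> \<phi> ` set P" using assms(5,6) by (simp_all add: subsetD)
  then obtain a p where ap: "a \<in> set A" "\<phi> a = \<phi> y" "p \<in> set P" "\<phi> p = \<phi> y"
    by (elim imageE) simp
  have "(a, p) \<in> R'" using assms(2,3) ap by (auto simp: sorted_wrt_append)
  moreover have "(p, y) \<in> R'" "(y, a) \<in> R'" using assms(4) ap by auto
  ultimately have "three_cycle R' a p y" by (simp add: three_cycle_def)
  then show False using assms(1) ap unfolding monochromatic_def by metis
qed

text \<open>Splicing from the back of a list of blocks that all see the colour set \<open>S\<close>: each round
  uses up the first block as \<open>A\<close> and enriches the last untouched block by a colour outside \<open>S\<close>.\<close>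

lemma splice_rounds:
  fixes V :: "nat set"
  assumes "peo V R" "no_out_triangle R"
  shows "\<exists>V' R'. peo V' R' \<and> no_out_triangle R' \<and> V \<subseteq> V' \<and> R \<subseteq> R' \<and>
    (\<forall>\<phi> S fs. \<not> monochromatic \<phi> R' \<longrightarrow> 2 * i \<le> length fs \<longrightarrow> trans_list R (concat fs) \<longrightarrow>
      set (concat fs) \<subseteq> V \<longrightarrow> (\<forall>b\<in>set fs. S \<subseteq> \<phi> ` set b) \<longrightarrow>
      (\<exists>fs' cs. length fs' + 2 * i = length fs \<and> length cs = i \<and>
        trans_list R' (concat fs' @ concat cs) \<and> set (concat fs' @ concat cs) \<subseteq> V' \<and>
        (\<forall>b\<in>set fs'. S \<subseteq> \<phi> ` set b) \<and> (\<forall>c\<in>set cs. S \<subseteq> \<phi> ` set c \<and> \<not> \<phi> ` set c \<subseteq> S)))"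
proof (induction i)
  case 0
  show ?case
    by (intro exI[of _ V] exI[of _ R] conjI allI impI assms order_refl)
      (rule exI, rule exI[of _ "[]"], auto)
next
  case (Suc i)
  from Suc.IH obtain V1 R1 where V1: "peo V1 R1" "no_out_triangle R1" "V \<subseteq> V1" "R \<subseteq> R1"
    and IH: "\<forall>\<phi> S fs. \<not> monochromatic \<phi> R1 \<longrightarrow> 2 * i \<le> length fs \<longrightarrow> trans_list R (concat fs) \<longrightarrow>
      set (concat fs) \<subseteq> V \<longrightarrow> (\<forall>b\<in>set fs. S \<subseteq> \<phi> ` set b) \<longrightarrow>
      (\<exists>fs' cs. length fs' + 2 * i = length fs \<and> length cs = i \<and>
        trans_list R1 (concat fs' @ concat cs) \<and> set (concat fs' @ concat cs) \<subseteq> V1 \<and>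
        (\<forall>b\<in>set fs'. S \<subseteq> \<phi> ` set b) \<and> (\<forall>c\<in>set cs. S \<subseteq> \<phi> ` set c \<and> \<not> \<phi> ` set c \<subseteq> S))"
    by (elim exE conjE) (rule that)
  obtain V' R' where V': "peo V' R'" "no_out_triangle R'" "splice_extension V1 R1 V' R'"
    using splice_extension_exists[OF V1(1,2)] by blast
  then have mono: "V1 \<subseteq> V'" "R1 \<subseteq> R'" by (auto simp: splice_extension_def)
  show ?case
  proof (intro exI[of _ V'] exI[of _ R'] conjI allI impI V'(1,2) order_trans[OF V1(3) mono(1)]
      order_trans[OF V1(4) mono(2)])
    fix \<phi> S fs
    assume \<phi>: "\<not> monochromatic \<phi> R'" and fs: "2 * Suc i \<le> length fs" "trans_list R (concat fs)"
      "set (concat fs) \<subseteq> V" "\<forall>b\<in>set fs. S \<subseteq> \<phi> ` set b"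
    have nm: "\<not> monochromatic \<phi> R1" using \<phi> monochromatic_mono mono(2) by blast
    have "2 * i \<le> length fs" using fs(1) by simp
    from IH[THEN spec, THEN spec, THEN spec, THEN mp, OF nm, THEN mp, OF this, THEN mp, OF fs(2),
        THEN mp, OF fs(3), THEN mp, OF fs(4)] obtain fs' cs where len: "length fs' + 2 * i = length fs" "length cs = i"
      and fc: "trans_list R1 (concat fs' @ concat cs)" "set (concat fs' @ concat cs) \<subseteq> V1"
      "\<forall>b\<in>set fs'. S \<subseteq> \<phi> ` set b" "\<forall>c\<in>set cs. S \<subseteq> \<phi> ` set c \<and> \<not> \<phi> ` set c \<subseteq> S"
      by (elim exE conjE) (rule that)
    \<comment> \<open>A round consumes two blocks, \<open>a\<close> and \<open>p\<close>, which
      accounts for the factor 2 in the length condition.\<close>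
    have "2 \<le> length fs'" using len fs(1) by simp
    then obtain a gs where "fs' = a # gs" "gs \<noteq> []" by (cases fs'; cases "tl fs'") auto
    then obtain ms p where fs': "fs' = a # ms @ [p]" by (metis rev_exhaust)
    \<comment> \<open>The middle part is all of \<open>ms\<close> and \<open>p\<close>, so that
      \<open>y\<close> fits between \<open>p\<close> and the blocks enriched so far.\<close>
    have split: "trans_list R1 (a @ (concat ms @ p) @ concat cs)"
      "set (a @ (concat ms @ p) @ concat cs) \<subseteq> V1"
      using fc(1,2) by (simp_all add: fs')
    with V'(3) have "\<exists>y\<in>V'. {y} \<times> (set a \<union> set (concat cs)) \<union> set (concat ms @ p) \<times> {y} \<subseteq> R'"
      unfolding splice_extension_def by blast
    then obtain y where y: "y \<in> V'"
      "{y} \<times> (set a \<union> set (concat cs)) \<union> set (concat ms @ p) \<times> {y} \<subseteq> R'" ..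
    have S: "S \<subseteq> \<phi> ` set a" "S \<subseteq> \<phi> ` set p" using fc(3) by (simp_all add: fs')
    then have "S \<subseteq> \<phi> ` set (concat ms @ p)" by auto
    then have "\<phi> y \<notin> S" by (rule splice_colour[OF \<phi> mono(2) split(1) y(2) S(1)])
    define cs' where "cs' = (p @ [y]) # cs"
    \<comment> \<open>Arcs from \<open>y\<close> to \<open>a\<close> run against the order, so
      \<open>a\<close> is dropped; without it, inserting \<open>y\<close> after \<open>p\<close>
      keeps the list transitive.\<close>
    have "trans_list R' (concat ms @ p @ concat cs)"
      using trans_list_mono[OF fc(1) mono(2)] by (simp add: fs' sorted_wrt_append)
    then have "trans_list R' (concat ms @ concat cs')"
      using y(2) by (auto simp: cs'_def sorted_wrt_append)
    moreover have "set (concat ms @ concat cs') \<subseteq> V'"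
      using fc(2) mono(1) y(1) by (auto simp: fs' cs'_def)
    moreover have "\<forall>c\<in>set cs'. S \<subseteq> \<phi> ` set c \<and> \<not> \<phi> ` set c \<subseteq> S"
      using fc(4) \<open>\<phi> y \<notin> S\<close> S(2) by (simp add: cs'_def subset_insertI2)
    moreover have "length ms + 2 * Suc i = length fs" "length cs' = Suc i"
      using len by (simp_all add: fs' cs'_def)
    moreover have "\<forall>b\<in>set ms. S \<subseteq> \<phi> ` set b" using fc(3) by (simp add: fs')
    ultimately show "\<exists>fs' cs. length fs' + 2 * Suc i = length fs \<and> length cs = Suc i \<and>
        trans_list R' (concat fs' @ concat cs) \<and> set (concat fs' @ concat cs) \<subseteq> V' \<and>
        (\<forall>b\<in>set fs'. S \<subseteq> \<phi> ` set b) \<and> (\<forall>c\<in>set cs. S \<subseteq> \<phi> ` set c \<and> \<not> \<phi> ` set c \<subseteq> S)"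
      by (intro exI[of _ ms] exI[of _ cs'] conjI)
  qed
qed

lemma filter_pigeonhole:
  assumes "finite T" "g ` set xs \<subseteq> T" "card T * n < length xs"
  shows "\<exists>t\<in>T. n \<le> length (filter (\<lambda>x. g x = t) xs)"
proof (rule ccontr)
  assume n: "\<not> ?thesis"
  have "length xs = (\<Sum>t\<in>T. length (filter (\<lambda>x. g x = t) xs))"
    using assms(2)
  proof (induction xs)
    case (Cons x xs)
    have "(\<Sum>t\<in>T. length (filter (\<lambda>x. g x = t) (x # xs))) =
      (\<Sum>t\<in>T. length (filter (\<lambda>x. g x = t) xs) + (if g x = t then 1 else 0))"
      by (intro sum.cong) auto
    also have "\<dots> = (\<Sum>t\<in>T. length (filter (\<lambda>x. g x = t) xs)) + 1"
      using Cons.prems assms(1) by (simp add: sum.distrib)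
    finally show ?case using Cons by simp
  qed simp
  also have "\<dots> \<le> card T * n" using n by (intro sum_bounded_above[of T _ n, simplified]) auto
  finally show False using assms(3) by simp
qed

lemma trans_list_concat_filter:
  "trans_list R (concat cs) \<Longrightarrow> trans_list R (concat (filter P cs))"
  by (induction cs) (auto simp: sorted_wrt_append)

lemma trans_list_concat_take:
  "trans_list R (concat cs) \<Longrightarrow> trans_list R (concat (take n cs))"
  by (induction cs arbitrary: n) (auto simp: sorted_wrt_append take_Cons' dest: in_set_takeD)

text \<open>From 2 * m blocks showing \<open>S\<close>, m rounds of splicing yield m blocks that
  each show a colour outside \<open>S\<close> as well. With at most \<open>k\<close> colours and m =
  k * n + 1, some \<open>n\<close> of them share this colour, which joins \<open>S\<close>. Since
  the number of blocks shrinks, the induction on \<open>j\<close> needs all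
  \<open>n\<close>.\<close>

lemma forced_colours:
  "\<exists>(V :: nat set) R. peo V R \<and> no_out_triangle R \<and>
    (\<forall>\<phi>. card (\<phi> ` V) \<le> k \<longrightarrow> \<not> monochromatic \<phi> R \<longrightarrow>
      (\<exists>S bs. finite S \<and> card S = j \<and> length bs = n \<and> trans_list R (concat bs) \<and>
        set (concat bs) \<subseteq> V \<and> (\<forall>b\<in>set bs. S \<subseteq> \<phi> ` set b)))"
proof (induction j arbitrary: n)
  case 0
  show ?case
    \<comment> \<open>\<open>n\<close> empty blocks show the empty set of colours.\<close>
    by (intro exI[of _ "{}"] exI[of _ "replicate n []"] conjI allI impI peo.empty)
      (auto simp: no_out_triangle_def)
next
  case (Suc j)
  define m where "m = k * n + 1"
  from Suc[of "2 * m"] obtain V :: "nat set" and R where V: "peo V R" "no_out_triangle R"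
    and forced: "\<And>\<phi>. card (\<phi> ` V) \<le> k \<Longrightarrow> \<not> monochromatic \<phi> R \<Longrightarrow>
      (\<exists>S bs. finite S \<and> card S = j \<and> length bs = 2 * m \<and> trans_list R (concat bs) \<and>
        set (concat bs) \<subseteq> V \<and> (\<forall>b\<in>set bs. S \<subseteq> \<phi> ` set b))" by blast
  obtain V' R' where V': "peo V' R'" "no_out_triangle R'" "V \<subseteq> V'" "R \<subseteq> R'"
    and rounds: "\<forall>\<phi> S fs. \<not> monochromatic \<phi> R' \<longrightarrow> 2 * m \<le> length fs \<longrightarrow> trans_list R (concat fs) \<longrightarrow>
      set (concat fs) \<subseteq> V \<longrightarrow> (\<forall>b\<in>set fs. S \<subseteq> \<phi> ` set b) \<longrightarrow>
      (\<exists>fs' cs. length fs' + 2 * m = length fs \<and> length cs = m \<and>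
        trans_list R' (concat fs' @ concat cs) \<and> set (concat fs' @ concat cs) \<subseteq> V' \<and>
        (\<forall>b\<in>set fs'. S \<subseteq> \<phi> ` set b) \<and> (\<forall>c\<in>set cs. S \<subseteq> \<phi> ` set c \<and> \<not> \<phi> ` set c \<subseteq> S))"
    using splice_rounds[OF V, of m] by (elim exE conjE) (rule that)
  show ?case
  proof (rule exI[of _ V'], rule exI[of _ R'], intro conjI allI impI V'(1,2))
    fix \<phi> :: "nat \<Rightarrow> nat" assume \<phi>: "card (\<phi> ` V') \<le> k" "\<not> monochromatic \<phi> R'"
    have fin: "finite (\<phi> ` V')" using peo_finite[OF V'(1)] by simp
    have le: "card (\<phi> ` V) \<le> k"
      using \<phi>(1) card_mono[OF fin image_mono[OF V'(3)]] by linarith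
    have nm: "\<not> monochromatic \<phi> R" using \<phi>(2) monochromatic_mono V'(4) by blast
    obtain S bs where S: "finite S" "card S = j" and bs: "length bs = 2 * m"
      "trans_list R (concat bs)" "set (concat bs) \<subseteq> V" "\<forall>b\<in>set bs. S \<subseteq> \<phi> ` set b"
      using forced[OF le nm] by (elim exE conjE) (rule that)
    have "2 * m \<le> length bs" using bs(1) by simp
    from rounds[THEN spec, THEN spec, THEN spec, THEN mp, OF \<phi>(2), THEN mp, OF this, THEN mp,
        OF bs(2), THEN mp, OF bs(3), THEN mp, OF bs(4)] obtain fs' cs where
      "length cs = m" "trans_list R' (concat fs' @ concat cs)" "set (concat fs' @ concat cs) \<subseteq> V'"
      and c: "\<forall>c\<in>set cs. S \<subseteq> \<phi> ` set c \<and> \<not> \<phi> ` set c \<subseteq> S"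
      by (elim exE conjE) (rule that)
    then have cs: "length cs = m" "trans_list R' (concat cs)" "set (concat cs) \<subseteq> V'"
      by (simp_all add: sorted_wrt_append)
    define new where "new c = (SOME t. t \<in> \<phi> ` set c - S)" for c
    have new: "new c \<in> \<phi> ` set c - S" if "c \<in> set cs" for c
    proof -
      have "\<exists>t. t \<in> \<phi> ` set c - S" using bspec[OF c that] by blast
      then show ?thesis unfolding new_def by (rule someI_ex)
    qed
    have "new ` set cs \<subseteq> \<phi> ` V'"
    proof
      fix t assume "t \<in> new ` set cs"
      then obtain d where d: "d \<in> set cs" "t = new d" by blast
      then have "t \<in> \<phi> ` set d" using new[OF d(1)] by simp
      moreover have "set d \<subseteq> V'" using cs(3) d(1) by auto
      ultimately show "t \<in> \<phi> ` V'" by blast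
    qed
    moreover have "card (\<phi> ` V') * n < length cs"
      using mult_le_mono1[OF \<phi>(1), of n] unfolding cs(1) m_def by linarith
    ultimately obtain t where t: "n \<le> length (filter (\<lambda>c. new c = t) cs)"
      using filter_pigeonhole[OF fin, of new cs n] by blast
    define ds where "ds = take n (filter (\<lambda>c. new c = t) cs)"
    have sub: "set ds \<subseteq> {c \<in> set cs. new c = t}" unfolding ds_def by (auto dest: in_set_takeD)
    show "\<exists>S bs. finite S \<and> card S = Suc j \<and> length bs = n \<and> trans_list R' (concat bs) \<and>
        set (concat bs) \<subseteq> V' \<and> (\<forall>b\<in>set bs. S \<subseteq> \<phi> ` set b)"
    proof (cases "n = 0")
      \<comment> \<open>With no blocks, nothing shows that \<open>t\<close> lies outside
        \<open>S\<close>; any fresh number can enlarge \<open>S\<close> instead.\<close>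
      case True
      obtain t' where "t' \<notin> S" using S(1) ex_new_if_finite infinite_UNIV_nat by blast
      then show ?thesis using S True by (intro exI[of _ "insert t' S"] exI[of _ "[]"]) auto
    next
      case False
      have len: "length ds = n" using t by (simp add: ds_def)
      then have "ds \<noteq> []" using False by auto
      then obtain d where "d \<in> set ds" by (meson list.set_sel(1))
      then have "d \<in> set cs" "new d = t" using sub by auto
      then have "t \<notin> S" using new[of d] by simp
      moreover have "trans_list R' (concat ds)"
        unfolding ds_def by (intro trans_list_concat_take trans_list_concat_filter cs)
      moreover have "set (concat ds) \<subseteq> V'" using cs(3) sub by auto
      moreover have "\<forall>b\<in>set ds. insert t S \<subseteq> \<phi> ` set b"
      proof
        fix b assume "b \<in> set ds"
        then have b: "b \<in> set cs" "new b = t" using sub by auto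
        then show "insert t S \<subseteq> \<phi> ` set b" using new[OF b(1)] bspec[OF c b(1)] by simp
      qed
      ultimately show ?thesis
        using S len by (intro exI[of _ "insert t S"] exI[of _ ds]) simp
    qed
  qed
qed

text \<open>A single block showing \<open>Suc k\<close> colours cannot occur in a colouring with at
  most \<open>k\<close> colours, so a monochromatic triangle is unavoidable.\<close>

lemma uncolourable_no_out_triangle:
  "\<exists>(V :: nat set) R. peo V R \<and> no_out_triangle R \<and> uncolourable k V R"
proof -
  obtain V :: "nat set" and R where V: "peo V R" "no_out_triangle R"
    and forced: "\<And>\<phi>. card (\<phi> ` V) \<le> k \<Longrightarrow> \<not> monochromatic \<phi> R \<Longrightarrow>
      (\<exists>S bs. finite S \<and> card S = Suc k \<and> length bs = 1 \<and> trans_list R (concat bs) \<and>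
        set (concat bs) \<subseteq> V \<and> (\<forall>b\<in>set bs. S \<subseteq> \<phi> ` set b))"
    using forced_colours[of k "Suc k" 1] by blast
  have "uncolourable k V R"
    unfolding uncolourable_def
  proof (intro allI impI, rule ccontr)
    fix \<phi> :: "nat \<Rightarrow> nat" assume \<phi>: "card (\<phi> ` V) \<le> k" "\<not> monochromatic \<phi> R"
    obtain S bs where S: "card S = Suc k" "length bs = 1" "set (concat bs) \<subseteq> V"
      "\<forall>b\<in>set bs. S \<subseteq> \<phi> ` set b" using forced[OF \<phi>] by blast
    obtain b where "bs = [b]" using S(2) by (cases bs) auto
    then have "set b \<subseteq> V" "S \<subseteq> \<phi> ` set b" using S(3,4) by simp_all
    then have "S \<subseteq> \<phi> ` V" by (meson image_mono order_trans)
    then have "card S \<le> card (\<phi> ` V)" using peo_finite[OF V(1)] by (intro card_mono) auto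
    then show False using S(1) \<phi>(1) by simp
  qed
  then show ?thesis using V by blast
qed

section \<open>Reversing all arcs\<close>

lemma three_cycle_converse: "three_cycle (R\<inverse>) a b c \<longleftrightarrow> three_cycle R c b a"
  by (auto simp: three_cycle_def)

lemma peo_converse: "peo V R \<Longrightarrow> peo V (R\<inverse>)"
proof (induction rule: peo.induct)
  case (insert V R x A B)
  have "peo (insert x V) (R\<inverse> \<union> {x} \<times> B \<union> A \<times> {x})"
  proof (rule peo.insert[OF insert.IH insert.hyps(2,4,3)])
    show "B \<inter> A = {}" using insert.hyps(5) by blast
    show "clique (R\<inverse>) (B \<union> A)" using insert.hyps(6) by (auto simp: clique_def)
  qed
  moreover have "R\<inverse> \<union> {x} \<times> B \<union> A \<times> {x} = (R \<union> {x} \<times> A \<union> B \<times> {x})\<inverse>" by auto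
  ultimately show ?case by simp
qed (simp add: peo.empty)

lemma uncolourable_converse: "uncolourable k V R \<Longrightarrow> uncolourable k V (R\<inverse>)"
  unfolding uncolourable_def monochromatic_def three_cycle_converse by metis

section \<open>Heroes\<close>

lemma embeds_comp:
  "embeds V R W Q f \<Longrightarrow> embeds W Q U P g \<Longrightarrow> embeds V R U P (g \<circ> f)"
  unfolding embeds_def by (simp add: inj_on_def image_subset_iff)

lemma embeds_inverse:
  assumes "bij_betw g W V" "embeds W Q V R g"
  shows "bij_betw (inv_into W g) V W" "embeds V R W Q (inv_into W g)"
proof -
  let ?h = "inv_into W g"
  show h: "bij_betw ?h V W" using assms(1) by (rule bij_betw_inv_into)
  have "(a, b) \<in> R \<longleftrightarrow> (?h a, ?h b) \<in> Q" if "a \<in> V" "b \<in> V" for a b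
  proof -
    have "?h a \<in> W" "?h b \<in> W" using h that by (auto simp: bij_betw_def)
    then have "(?h a, ?h b) \<in> Q \<longleftrightarrow> (g (?h a), g (?h b)) \<in> R"
      using assms(2) by (simp add: embeds_def)
    then show ?thesis using bij_betw_inv_into_right[OF assms(1)] that by simp
  qed
  then show "embeds V R W Q ?h" using h by (simp add: embeds_def bij_betw_def)
qed

lemma trans_list_nth_iff:
  assumes "trans_list R xs" "\<And>a b. (a, b) \<in> R \<Longrightarrow> (b, a) \<notin> R" "i < length xs" "j < length xs"
  shows "(xs ! i, xs ! j) \<in> R \<longleftrightarrow> i < j"
proof (cases i j rule: linorder_cases)
  case less
  then show ?thesis using sorted_wrt_nth_less[OF assms(1) less assms(4)] by simp
next
  case equal
  then show ?thesis using assms(2)[of "xs ! i" "xs ! i"] by auto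
next
  case greater
  then show ?thesis
    using sorted_wrt_nth_less[OF assms(1) greater assms(3)] assms(2)[of "xs ! j" "xs ! i"] by auto
qed

lemma trans_list_embeds:
  assumes "trans_list R xs" "\<And>a b. (a, b) \<in> R \<Longrightarrow> (b, a) \<notin> R" "set xs \<subseteq> V"
  shows "embeds {..<length xs} {(i, j). i < j \<and> j < length xs} V R (nth xs)"
proof -
  have "distinct xs" using assms(1) by (rule trans_list_distinct) (use assms(2) in blast)
  then have "inj_on (nth xs) {..<length xs}" by (intro inj_on_nth) auto
  then show ?thesis
    using assms(3) trans_list_nth_iff[OF assms(1,2)] by (auto simp: embeds_def)
qed

definition C3_map :: "'a \<Rightarrow> 'a \<Rightarrow> 'a list \<Rightarrow> nat + nat + nat \<Rightarrow> 'a" where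
  "C3_map u v xs = case_sum (\<lambda>_. u) (case_sum (\<lambda>_. v) (nth xs))"

lemma C3_TT_verts: "pverts (C3 (TT 1) (TT 1) (TT k)) = insert (Inl 0) (insert (Inr (Inl 0)) ((Inr \<circ> Inr) ` {..<k}))"
  by (auto simp: C3_def TT_def Let_def)

lemma C3_TT_arcs:
  "(Inl 0, Inl 0) \<notin> parcs (C3 (TT 1) (TT 1) (TT k))"
  "(Inl 0, Inr (Inl 0)) \<in> parcs (C3 (TT 1) (TT 1) (TT k))"
  "(Inr (Inl 0), Inl 0) \<notin> parcs (C3 (TT 1) (TT 1) (TT k))"
  "(Inr (Inl 0), Inr (Inl 0)) \<notin> parcs (C3 (TT 1) (TT 1) (TT k))"
  "(Inl 0, Inr (Inr i)) \<notin> parcs (C3 (TT 1) (TT 1) (TT k))"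
  "(Inr (Inr i), Inr (Inl 0)) \<notin> parcs (C3 (TT 1) (TT 1) (TT k))"
  "(Inr (Inl 0), Inr (Inr i)) \<in> parcs (C3 (TT 1) (TT 1) (TT k)) \<longleftrightarrow> i < k"
  "(Inr (Inr i), Inl 0) \<in> parcs (C3 (TT 1) (TT 1) (TT k)) \<longleftrightarrow> i < k"
  "(Inr (Inr i), Inr (Inr j)) \<in> parcs (C3 (TT 1) (TT 1) (TT k)) \<longleftrightarrow> i < j \<and> j < k"
  by (auto simp: C3_def TT_def Let_def)

lemma C3_TT_subset:
  "parcs (C3 (TT 1) (TT 1) (TT k)) \<subseteq>
    pverts (C3 (TT 1) (TT 1) (TT k)) \<times> pverts (C3 (TT 1) (TT 1) (TT k))"
  by (auto simp: C3_def TT_def Let_def)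

text \<open>Any two vertices of the pattern excluded by \<open>fan_free\<close> are joined, so
  asymmetry settles all nonarcs and the copy is automatically induced.\<close>

lemma C3_map_embeds:
  assumes "(u, v) \<in> R" "trans_list R xs" "\<And>y. y \<in> set xs \<Longrightarrow> (v, y) \<in> R \<and> (y, u) \<in> R"
    and asym: "\<And>a b. (a, b) \<in> R \<Longrightarrow> (b, a) \<notin> R" and "R \<subseteq> V \<times> V"
  defines "C \<equiv> C3 (TT 1) (TT 1) (TT (length xs))"
  shows "embeds (pverts C) (parcs C) V R (C3_map u v xs)"
    and "C3_map u v xs ` pverts C = insert u (insert v (set xs))"
proof -
  let ?g = "C3_map u v xs"
  have g: "?g (Inl i) = u" "?g (Inr (Inl i)) = v" "?g (Inr (Inr i)) = xs ! i" for i
    by (simp_all add: C3_map_def)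
  have verts: "pverts C = insert (Inl 0) (insert (Inr (Inl 0)) ((Inr \<circ> Inr) ` {..<length xs}))"
    unfolding C_def by (rule C3_TT_verts)
  have xs: "(\<lambda>i. xs ! i) ` {..<length xs} = set xs" by (auto simp: set_conv_nth)
  show img: "?g ` pverts C = insert u (insert v (set xs))"
    unfolding verts xs[symmetric] by (simp add: g image_image)
  have irr: "(a, a) \<notin> R" for a using asym[of a a] by blast
  have nth: "(v, xs ! i) \<in> R" "(xs ! i, u) \<in> R" "(xs ! i, v) \<notin> R" "(u, xs ! i) \<notin> R"
    "xs ! i \<noteq> u" "xs ! i \<noteq> v" if "i < length xs" for i
    using assms(3)[OF nth_mem[OF that]] asym irr by metis+
  have uv: "(v, u) \<notin> R" "u \<noteq> v" using asym[OF assms(1)] irr assms(1) by auto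
  have "distinct xs" using assms(2) irr by (rule trans_list_distinct)
  have cases: "a = Inl 0 \<or> a = Inr (Inl 0) \<or> (\<exists>i<length xs. a = Inr (Inr i))" if "a \<in> pverts C" for a
    using that unfolding verts by auto
  have arcs: "(a, b) \<in> parcs C \<longleftrightarrow> (?g a, ?g b) \<in> R" and inj: "?g a = ?g b \<Longrightarrow> a = b"
    if "a \<in> pverts C" "b \<in> pverts C" for a b
  proof -
    from cases[OF that(1)] cases[OF that(2)] show "(a, b) \<in> parcs C \<longleftrightarrow> (?g a, ?g b) \<in> R"
      unfolding C_def
      by (elim disjE exE conjE)
        (simp_all add: g C3_TT_arcs nth irr uv assms(1) trans_list_nth_iff[OF assms(2) asym] del: One_nat_def)
    from cases[OF that(1)] cases[OF that(2)] show "a = b" if "?g a = ?g b"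
      using that by (elim disjE exE conjE)
        (simp_all add: g uv nth uv(2)[symmetric] nth(5,6)[symmetric] nth_eq_iff_index_eq[OF \<open>distinct xs\<close>])
  qed
  have "insert u (insert v (set xs)) \<subseteq> V" using assms(1,3,5) by blast
  then show "embeds (pverts C) (parcs C) V R ?g"
    unfolding embeds_def using arcs inj img by (auto intro!: inj_onI)
qed

text \<open>A monochromatic triangle is a closed walk inside one colour class, so no colouring with
  at most \<open>k\<close> colours has acyclic classes.\<close>

lemma uncolourable_dichromatic:
  assumes "peo (pverts D) (parcs D)" "uncolourable k (pverts D) (parcs D)"
  shows "k < dichromatic_number D"
proof (rule ccontr)
  assume "\<not> k < dichromatic_number D"
  then obtain \<phi> :: "'a \<Rightarrow> nat" where \<phi>: "card (\<phi> ` pverts D) \<le> k"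
    "\<And>c. acyclic (parcs D \<inter> {v \<in> pverts D. \<phi> v = c} \<times> {v \<in> pverts D. \<phi> v = c})"
    using dichromatic_number_le_iff[OF peo_pair_digraph[OF assms(1)], of k] by (auto simp: not_less)
  then obtain a b c where t: "three_cycle (parcs D) a b c" "\<phi> a = \<phi> b" "\<phi> b = \<phi> c"
    using assms(2) unfolding uncolourable_def monochromatic_def by blast
  let ?X = "{v \<in> pverts D. \<phi> v = \<phi> a}"
  let ?R = "parcs D \<inter> ?X \<times> ?X"
  have "(a, b) \<in> ?R" "(b, c) \<in> ?R" "(c, a) \<in> ?R"
    using t peo_subset[OF assms(1)] by (auto simp: three_cycle_def)
  then have "(a, a) \<in> ?R\<^sup>+" by (meson trancl.intros)
  then show False using \<phi>(2)[of "\<phi> a"] by (simp add: acyclic_def)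
qed

text \<open>Some member of the family exceeds the bound belonging to \<open>H\<close> and therefore
  contains \<open>H\<close>. \<open>P\<close> is the property of the family from which structure of
  \<open>H\<close> is read off.\<close>

lemma hero_embeds:
  fixes H :: "'a pair_pre_digraph"
  assumes "hero_in oriented_chordal_graphs H" "pair_digraph H"
    and "\<And>k. \<exists>(V :: nat set) R. peo V R \<and> P V R \<and> uncolourable k V R"
  shows "\<exists>V R f. peo V R \<and> P V R \<and> embeds (pverts H) (parcs H) V R f"
proof -
  obtain c where c: "\<And>D. D \<in> oriented_chordal_graphs \<Longrightarrow> \<not> contains_induced D H \<Longrightarrow>
    dichromatic_number D \<le> c"
    using assms(1) unfolding hero_in_def by blast
  obtain V :: "nat set" and R where V: "peo V R" "P V R" "uncolourable c V R" using assms(3) by blast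
  let ?D = "\<lparr>pverts = V, parcs = R\<rparr>"
  have "peo (pverts ?D) (parcs ?D)" "uncolourable c (pverts ?D) (parcs ?D)" using V by simp_all
  note D = peo_pair_digraph[OF this(1)] peo_oriented_chordal[OF this(1)] uncolourable_dichromatic[OF this]
  have "contains_induced ?D H"
    using c[of ?D] D(2,3) by (auto simp: oriented_chordal_graphs_def)
  then have "\<exists>f. embeds (pverts H) (parcs H) V R f"
    using contains_induced_iff_embeds[of H ?D] D(1) assms(2)
    by (simp add: pair_digraph.pair_wf_digraph)
  then show ?thesis using V by blast
qed

lemma embeds_arc_iff:
  "embeds V R W Q f \<Longrightarrow> a \<in> V \<Longrightarrow> b \<in> V \<Longrightarrow> (f a, f b) \<in> Q \<longleftrightarrow> (a, b) \<in> R"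
  by (simp add: embeds_def)

lemma embeds_eq_iff:
  "embeds V R W Q f \<Longrightarrow> a \<in> V \<Longrightarrow> b \<in> V \<Longrightarrow> f a = f b \<longleftrightarrow> a = b"
  by (auto simp: embeds_def dest: inj_onD)

lemma embeds_three_cycle:
  "embeds V R W Q f \<Longrightarrow> a \<in> V \<Longrightarrow> b \<in> V \<Longrightarrow> c \<in> V \<Longrightarrow> three_cycle Q (f a) (f b) (f c) \<longleftrightarrow> three_cycle R a b c"
  by (simp add: three_cycle_def embeds_arc_iff)

lemma embeds_triangle_free:
  assumes "embeds V R W Q f" "Y \<subseteq> V"
  shows "triangle_free Q (f ` Y) \<longleftrightarrow> triangle_free R Y"
proof -
  have "three_cycle Q (f a) (f b) (f c) \<longleftrightarrow> three_cycle R a b c" if "a \<in> Y" "b \<in> Y" "c \<in> Y" for a b c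
    using that assms(2) by (intro embeds_three_cycle[OF assms(1)]) auto
  then show ?thesis unfolding triangle_free_def by simp
qed

lemma embeds_clique: "embeds V R W Q f \<Longrightarrow> clique Q (f ` V) \<longleftrightarrow> clique R V"
  unfolding clique_def by (simp add: embeds_arc_iff embeds_eq_iff)

lemma embeds_wheel_free:
  assumes emb: "embeds V R W Q f" and wf: "wheel_free R V"
  shows "wheel_free Q (f ` V)"
  unfolding wheel_free_def
proof (intro allI ballI impI)
  fix Y x assume Y: "Y \<subseteq> f ` V" "x \<in> f ` V" "(\<forall>y\<in>Y. (x, y) \<in> Q) \<or> (\<forall>y\<in>Y. (y, x) \<in> Q)"
  obtain Z where Z: "Z \<subseteq> V" "Y = f ` Z" using Y(1) by (meson subset_imageE)
  obtain z where z: "z \<in> V" "x = f z" using Y(2) by blast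
  have "(f z, f y) \<in> Q \<longleftrightarrow> (z, y) \<in> R" "(f y, f z) \<in> Q \<longleftrightarrow> (y, z) \<in> R" if "y \<in> Z" for y
    using that Z(1) z(1) by (simp_all add: embeds_arc_iff[OF emb] subsetD)
  then have "(\<forall>y\<in>Z. (z, y) \<in> R) \<or> (\<forall>y\<in>Z. (y, z) \<in> R)"
    using Y(3) unfolding Z(2) z(2) by simp
  then have "triangle_free R Z" using wf Z(1) z(1) unfolding wheel_free_def by blast
  then show "triangle_free Q Y" unfolding Z(2) using embeds_triangle_free[OF emb Z(1)] by simp
qed

lemma embeds_fan_shaped:
  assumes emb: "embeds V R W Q f" and fs: "fan_shaped Q (f ` V)"
  shows "fan_shaped R V"
proof -
  obtain u v Y where Y: "f ` V = insert u (insert v Y)" "Y \<noteq> {}" "(u, v) \<in> Q"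
    "\<forall>y\<in>Y. (v, y) \<in> Q \<and> (y, u) \<in> Q" "triangle_free Q Y"
    using fs unfolding fan_shaped_def by blast
  have "Y \<subseteq> f ` V" "u \<in> f ` V" "v \<in> f ` V" unfolding Y(1) by auto
  then obtain Z a b where Z: "Z \<subseteq> V" "Y = f ` Z" and a: "a \<in> V" "u = f a" and b: "b \<in> V" "v = f b"
    by (auto simp: subset_image_iff)
  have "f ` V = f ` insert a (insert b Z)" using Y(1) Z a b by simp
  moreover have "inj_on f V" using emb by (simp add: embeds_def)
  ultimately have "V = insert a (insert b Z)"
    using inj_on_image_eq_iff[of f V V "insert a (insert b Z)"] Z a b by simp
  then show ?thesis
  proof (rule fan_shapedI)
    show "Z \<noteq> {}" using Y(2) Z(2) by auto
    show "(a, b) \<in> R" using Y(3) a b embeds_arc_iff[OF emb] by simp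
    show "(b, y) \<in> R" "(y, a) \<in> R" if "y \<in> Z" for y
      using Y(4) Z a b that embeds_arc_iff[OF emb, of b y] embeds_arc_iff[OF emb, of y a] by auto
    show "triangle_free R Z" using Y(5) Z embeds_triangle_free[OF emb Z(1)] by simp
  qed
qed

lemma no_out_triangle_embeds:
  assumes "embeds V R W Q f" "no_out_triangle Q" "x \<in> V" "Y \<subseteq> V" "\<forall>y\<in>Y. (x, y) \<in> R"
  shows "triangle_free R Y"
  unfolding triangle_free_def
proof (intro ballI notI)
  fix a b c assume abc: "a \<in> Y" "b \<in> Y" "c \<in> Y" "three_cycle R a b c"
  then have V: "a \<in> V" "b \<in> V" "c \<in> V" using assms(4) by auto
  have "(f x, f a) \<in> Q" "(f x, f b) \<in> Q" "(f x, f c) \<in> Q"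
    using abc V assms(3,5) by (simp_all add: embeds_arc_iff[OF assms(1)])
  moreover have "three_cycle Q (f a) (f b) (f c)"
    using abc V by (simp add: embeds_three_cycle[OF assms(1)])
  ultimately show False using assms(2) unfolding no_out_triangle_def by blast
qed

lemma embeds_converse: "embeds V R W (Q\<inverse>) f \<Longrightarrow> embeds V (R\<inverse>) W Q f"
  by (auto simp: embeds_def)

lemma triangle_free_converse: "triangle_free (R\<inverse>) Y \<longleftrightarrow> triangle_free R Y"
  unfolding triangle_free_def three_cycle_converse by blast

text \<open>A triangle-free tournament is acyclic, so \<open>Y\<close> can be listed transitively.
  The map built from this list goes from C3(1,1,k) to \<open>H\<close>; its inverse is the required
  isomorphism.\<close>

lemma fan_shaped_iso_C3:
  assumes "pair_digraph H" "tournament H" "fan_shaped (parcs H) (pverts H)"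
  shows "\<exists>k\<ge>1. digraph_iso (with_proj H) (with_proj (C3 (TT 1) (TT 1) (TT k)))"
proof -
  interpret pair_digraph H by fact
  have asym: "(b, a) \<notin> parcs H" if "(a, b) \<in> parcs H" for a b
    using assms(2) that in_arcsD1[OF that] in_arcsD2[OF that] no_loops' unfolding tournament_def by blast
  have sub: "parcs H \<subseteq> pverts H \<times> pverts H" by (auto dest: in_arcsD1 in_arcsD2)
  have "clique (parcs H) (pverts H)" using assms(2) unfolding clique_def tournament_def by blast
  moreover have "parcs H \<inter> (parcs H)\<inverse> = {}" using asym by blast
  ultimately have peo: "peo (pverts H) (parcs H)" using pair_finite_verts sub by (intro clique_peo)
  obtain u v Y where Y: "pverts H = insert u (insert v Y)" "Y \<noteq> {}" "(u, v) \<in> parcs H"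
    "\<forall>y\<in>Y. (v, y) \<in> parcs H \<and> (y, u) \<in> parcs H" "triangle_free (parcs H) Y"
    using assms(3) unfolding fan_shaped_def by blast
  have "acyclic (parcs H \<inter> Y \<times> Y)"
    using Y(5) by (intro peo_acyclic[OF peo]) (auto simp: triangle_free_def)
  moreover have "finite Y" using pair_finite_verts Y(1) by simp
  moreover have "clique (parcs H) Y" using \<open>clique (parcs H) (pverts H)\<close>
    by (rule clique_subset) (use Y(1) in auto)
  ultimately obtain xs where xs: "set xs = Y" "trans_list (parcs H) xs"
    using acyclic_clique_trans_list by blast
  let ?C = "C3 (TT 1) (TT 1) (TT (length xs))"
  have emb: "embeds (pverts ?C) (parcs ?C) (pverts H) (parcs H) (C3_map u v xs)"
    by (rule C3_map_embeds(1)) (use Y xs asym sub in auto)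
  have "C3_map u v xs ` pverts ?C = pverts H"
    unfolding Y(1) xs(1)[symmetric] by (rule C3_map_embeds(2)) (use Y xs asym sub in auto)
  then have "bij_betw (C3_map u v xs) (pverts ?C) (pverts H)"
    using emb by (simp add: embeds_def bij_betw_def)
  note inv = embeds_inverse[OF this emb]
  have "digraph_iso (with_proj H) (with_proj ?C)"
    using digraph_isoI[OF pair_wf_digraph inv(1) C3_TT_subset inv(2)] by (simp add: with_proj_def)
  moreover have "1 \<le> length xs" using Y(2) xs(1) by (cases xs) auto
  ultimately show ?thesis by blast
qed

lemma hero_imp:
  assumes "pair_digraph H" "hero_in oriented_chordal_graphs H"
  shows "transitive_tournament H \<or>
    (\<exists>k::nat. k \<ge> 1 \<and> digraph_iso (with_proj H) (with_proj (C3 (TT 1) (TT 1) (TT k))))"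
proof -
  interpret pair_digraph H by fact
  let ?V = "pverts H" and ?R = "parcs H"
  from hero_embeds[OF assms(2,1) uncolourable_tournament] obtain W :: "nat set" and Q f where
    W: "peo W Q" "clique Q W" "embeds ?V ?R W Q f" by blast
  have "clique Q (f ` ?V)" using W(2) by (rule clique_subset) (use W(3) in \<open>simp add: embeds_def\<close>)
  then have cl: "clique ?R ?V" using embeds_clique[OF W(3)] by simp
  have asym: "(b, a) \<notin> ?R" if "(a, b) \<in> ?R" for a b
    using that peo_asym[OF W(1)] embeds_arc_iff[OF W(3)] in_arcsD1 in_arcsD2 by metis
  have T: "tournament H"
    unfolding tournament_def using assms(1) cl asym unfolding clique_def by blast
  have out: "triangle_free ?R Y" if "x \<in> ?V" "Y \<subseteq> ?V" "\<forall>y\<in>Y. (x, y) \<in> ?R" for x Y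
  proof -
    from hero_embeds[OF assms(2,1) uncolourable_no_out_triangle]
    obtain U :: "nat set" and P g where "no_out_triangle P" "embeds ?V ?R U P g" by blast
    then show ?thesis using that by (intro no_out_triangle_embeds[of ?V ?R U P g x Y])
  qed
  \<comment> \<open>Reversal exchanges dominating and being dominated, and it preserves elimination
    orders and uncolourability.\<close>
  have "\<exists>(V :: nat set) R. peo V R \<and> no_out_triangle (R\<inverse>) \<and> uncolourable k V R" for k
  proof -
    obtain V :: "nat set" and R where "peo V R" "no_out_triangle R" "uncolourable k V R"
      using uncolourable_no_out_triangle by blast
    then have "peo V (R\<inverse>)" "no_out_triangle ((R\<inverse>)\<inverse>)" "uncolourable k V (R\<inverse>)"
      by (simp_all add: peo_converse uncolourable_converse)
    then show ?thesis by blast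
  qed
  from hero_embeds[OF assms(2,1) this] obtain U :: "nat set" and P g where
    U: "no_out_triangle (P\<inverse>)" "embeds ?V ?R U P g" by blast
  have inn: "triangle_free ?R Y" if "x \<in> ?V" "Y \<subseteq> ?V" "\<forall>y\<in>Y. (y, x) \<in> ?R" for x Y
  proof -
    have "embeds ?V (?R\<inverse>) U (P\<inverse>) g" using U(2) by (intro embeds_converse) simp
    from no_out_triangle_embeds[OF this U(1) that(1,2)] that(3) show ?thesis
      by (simp add: triangle_free_converse)
  qed
  have wheel: "wheel_free ?R ?V" unfolding wheel_free_def using out inn by blast
  obtain V' :: "nat set" and R' h where F: "fan_cliques V' R'" "embeds ?V ?R V' R' h"
    using hero_embeds[OF assms(2,1), of fan_cliques] uncolourable_fan_cliques by blast
  have "h ` ?V \<subseteq> V'" using F(2) by (simp add: embeds_def)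
  moreover have "clique R' (h ` ?V)" using cl embeds_clique[OF F(2)] by simp
  moreover have "wheel_free R' (h ` ?V)" using embeds_wheel_free[OF F(2) wheel] .
  ultimately have "triangle_free R' (h ` ?V) \<or> fan_shaped R' (h ` ?V)"
    using F(1) by (simp add: fan_cliques_def)
  then show ?thesis
  proof
    assume "triangle_free R' (h ` ?V)"
    then have tf: "triangle_free ?R ?V" using embeds_triangle_free[OF F(2) order_refl] by simp
    have sub: "?R \<subseteq> ?V \<times> ?V" by (auto dest: in_arcsD1 in_arcsD2)
    have "?R \<inter> ?R\<inverse> = {}" using asym by blast
    \<comment> \<open>A tournament has an elimination order of its own, which turns
      triangle-freeness of \<open>H\<close> into acyclicity.\<close>
    then have "peo ?V ?R" using pair_finite_verts sub cl by (intro clique_peo)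
    then have "acyclic (?R \<inter> ?V \<times> ?V)"
      using tf by (intro peo_acyclic) (auto simp: triangle_free_def)
    moreover have "?R \<inter> ?V \<times> ?V = ?R" using sub by blast
    ultimately show ?thesis
      using T acyclic_digraph_with_proj_iff[OF pair_wf_digraph] by (simp add: transitive_tournament_def)
  next
    assume "fan_shaped R' (h ` ?V)"
    then have "fan_shaped ?R ?V" by (rule embeds_fan_shaped[OF F(2)])
    then show ?thesis using fan_shaped_iso_C3[OF assms(1) T] by blast
  qed
qed

lemma imp_hero:
  assumes "pair_digraph H" "transitive_tournament H \<or>
    (\<exists>k::nat. k \<ge> 1 \<and> digraph_iso (with_proj H) (with_proj (C3 (TT 1) (TT 1) (TT k))))"
  shows "hero_in oriented_chordal_graphs H"
proof -
  interpret pair_digraph H by fact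
  \<comment> \<open>Both kinds of \<open>H\<close> reduce to \<open>fan_free k\<close>, with k
    depending on \<open>H\<close> alone and not on the digraph.\<close>
  have "\<exists>k. \<forall>D :: nat pair_pre_digraph. peo (pverts D) (parcs D) \<longrightarrow> \<not> contains_induced D H \<longrightarrow>
      fan_free k (parcs D)"
    using assms(2)
  proof (elim disjE exE conjE)
    assume T: "transitive_tournament H"
    have "clique (parcs H) (pverts H)"
      using T unfolding transitive_tournament_def tournament_def clique_def by blast
    moreover have "acyclic (parcs H)"
      using T acyclic_digraph_with_proj_iff[OF pair_wf_digraph] by (simp add: transitive_tournament_def)
    then have "acyclic (parcs H \<inter> pverts H \<times> pverts H)" by (rule acyclic_subset) auto
    ultimately obtain ys where ys: "set ys = pverts H" "distinct ys" "trans_list (parcs H) ys"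
      using acyclic_clique_trans_list[OF pair_finite_verts] by blast
    have asymH: "(b, a) \<notin> parcs H" if "(a, b) \<in> parcs H" for a b
      using that \<open>acyclic (parcs H)\<close> by (meson acyclic_def trancl.intros)
    have "bij_betw (nth ys) {..<length ys} (pverts H)" using bij_betw_nth[OF ys(2) refl] ys(1) by simp
    note inv = embeds_inverse[OF this trans_list_embeds[OF ys(3) asymH]]
    \<comment> \<open>The part \<open>xs\<close> of a fan is already a transitive tournament as
      large as \<open>H\<close>.\<close>
    have "fan_free (length ys) (parcs D)"
      if D: "peo (pverts D) (parcs D)" "\<not> contains_induced D H" for D :: "nat pair_pre_digraph"
      unfolding fan_free_def
    proof (intro notI, elim exE conjE)
      fix u v xs assume xs: "length xs = length ys" "trans_list (parcs D) xs" "(u, v) \<in> parcs D"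
        "\<forall>y\<in>set xs. (v, y) \<in> parcs D \<and> (y, u) \<in> parcs D"
      have "set xs \<subseteq> pverts D" using xs(4) peo_subset[OF D(1)] by auto
      from trans_list_embeds[OF xs(2) peo_asym[OF D(1)] this]
      have "embeds {..<length ys} {(i, j). i < j \<and> j < length ys} (pverts D) (parcs D) (nth xs)"
        unfolding xs(1) by simp
      from embeds_comp[OF inv(2) this] ys(1) show False
        using D contains_induced_iff_embeds[OF pair_wf_digraph, of D]
          pair_digraph.pair_wf_digraph[OF peo_pair_digraph[OF D(1)]] by auto
    qed
    then show ?thesis by blast
  next
    fix k assume iso: "digraph_iso (with_proj H) (with_proj (C3 (TT 1) (TT 1) (TT k)))"
    let ?C = "C3 (TT 1) (TT 1) (TT k)"
    obtain f where f: "embeds (pverts H) (parcs H) (pverts ?C) (parcs ?C) f"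
      using digraph_isoD[OF iso] by auto
    have "fan_free k (parcs D)"
      if D: "peo (pverts D) (parcs D)" "\<not> contains_induced D H" for D :: "nat pair_pre_digraph"
      unfolding fan_free_def
    proof (intro notI, elim exE conjE)
      fix u v xs assume xs: "length xs = k" "trans_list (parcs D) xs" "(u, v) \<in> parcs D"
        "\<forall>y\<in>set xs. (v, y) \<in> parcs D \<and> (y, u) \<in> parcs D"
      have "embeds (pverts ?C) (parcs ?C) (pverts D) (parcs D) (C3_map u v xs)"
        unfolding xs(1)[symmetric]
        by (rule C3_map_embeds(1)[OF xs(3,2) _ peo_asym[OF D(1)] peo_subset[OF D(1)]])
          (use xs(4) in auto)
      from embeds_comp[OF f this] show False
        using D contains_induced_iff_embeds[OF pair_wf_digraph, of D]
          pair_digraph.pair_wf_digraph[OF peo_pair_digraph[OF D(1)]] by auto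
    qed
    then show ?thesis by blast
  qed
  then obtain k where k: "\<And>D :: nat pair_pre_digraph. peo (pverts D) (parcs D) \<Longrightarrow>
      \<not> contains_induced D H \<Longrightarrow> fan_free k (parcs D)" by blast
  have "dichromatic_number D \<le> 2 ^ (2 * 2 ^ k + 2)"
    if D: "D \<in> oriented_chordal_graphs" "\<not> contains_induced D H" for D
  proof -
    have peo: "peo (pverts D) (parcs D)"
      using D(1) by (simp add: oriented_chordal_graphs_def oriented_chordal_iff_peo)
    obtain \<phi> :: "nat \<Rightarrow> nat" where \<phi>: "\<phi> ` pverts D \<subseteq> {..<2 ^ (2 * 2 ^ k + 2)}"
      "\<And>a b c. three_cycle (parcs D) a b c \<Longrightarrow> \<not> (\<phi> a = \<phi> b \<and> \<phi> b = \<phi> c)"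
      using fan_free_colouring[OF peo k[OF peo D(2)]] by blast
    have "card (\<phi> ` pverts D) \<le> 2 ^ (2 * 2 ^ k + 2)"
      using card_mono[OF _ \<phi>(1)] by simp
    moreover have "acyclic (parcs D \<inter> {v \<in> pverts D. \<phi> v = c} \<times> {v \<in> pverts D. \<phi> v = c})" for c
    proof (rule peo_acyclic[OF peo])
      fix a b d
      assume "a \<in> {v \<in> pverts D. \<phi> v = c}" "b \<in> {v \<in> pverts D. \<phi> v = c}"
        "d \<in> {v \<in> pverts D. \<phi> v = c}"
      then show "\<not> three_cycle (parcs D) a b d" using \<phi>(2)[of a b d] by auto
    qed
    ultimately show ?thesis
      unfolding dichromatic_number_le_iff[OF peo_pair_digraph[OF peo]] by blast
  qed
  then show ?thesis unfolding hero_in_def by blast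
qed

theorem theorem10p1p1:
  fixes H :: "'a pair_pre_digraph"
  assumes "pair_digraph H"
  shows "hero_in oriented_chordal_graphs H \<longleftrightarrow>
    transitive_tournament H \<or>
    (\<exists>k::nat. k \<ge> 1 \<and> digraph_iso (with_proj H) (with_proj (C3 (TT 1) (TT 1) (TT k))))"
  using hero_imp[OF assms] imp_hero[OF assms] by blast

end
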